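(* If $X$ and $Y$ are Banach spaces with Schauder frames, then the projective tensor product $X\widehat{\otimes}_{\pi}Y$ has a Schauder frame.
   Context: Banach spaces are over $\mathbb{K}\in\{\mathbb{R},\mathbb{C}\}$; $X^*$ denotes the topological dual of $X$. A Schauder frame of a Banach space $X$ is a sequence $\{(x_n,f_n)\}_{n\ge 1}\subset X\times X^*$ such that for every $x\in X$ the series $\sum_n f_n(x)x_n$ converges in norm to $x$. $X\widehat{\otimes}_{\pi}Y$ is the completion of the algebraic tensor product $X\otimes Y$ for the projective norm $\pi(u)=\inf\{\sum_{i}\|x_i\|\|y_i\| : u=\sum_{i} x_i\otimes y_i\}$ (finite sums). *)

theory Defs
  imports "HOL-Analysis.Analysis" "HOL-Library.Poly_Mapping"
begin

section \<open>Normed spaces with an explicit carrier\<close>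

text \<open>
  The scalars are a type of class \<open>{real_normed_field, banach}\<close>.  Its instances include \<open>real\<close> and
  \<open>complex\<close>; as the norm of a \<open>real_normed_field\<close> is multiplicative, every instance is
  isometrically isomorphic to one of these two (Gelfand--Mazur).

  A tensor product depends on the scalar multiplications of its factors, which are terms and not
  part of a type, so it cannot be a type of its own.  It is a structure with an explicit carrier.
\<close>

record ('k, 'v) normed_structure =
  carrier :: "'v set"
  vadd :: "'v \<Rightarrow> 'v \<Rightarrow> 'v"
  vzero :: 'v
  vscale :: "'k \<Rightarrow> 'v \<Rightarrow> 'v"
  vnorm :: "'v \<Rightarrow> real"

definition vdist :: "('k::real_normed_field, 'v) normed_structure \<Rightarrow> 'v \<Rightarrow> 'v \<Rightarrow> real" where
  "vdist E u v = vnorm E (vadd E u (vscale E (- 1) v))"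

definition vsum :: "('k, 'v) normed_structure \<Rightarrow> 'v list \<Rightarrow> 'v" where
  "vsum E us = foldr (vadd E) us (vzero E)"

definition vCauchy :: "('k::real_normed_field, 'v) normed_structure \<Rightarrow> (nat \<Rightarrow> 'v) \<Rightarrow> bool" where
  "vCauchy E s \<longleftrightarrow> (\<forall>n. s n \<in> carrier E) \<and>
     (\<forall>e>0. \<exists>M. \<forall>m\<ge>M. \<forall>n\<ge>M. vdist E (s m) (s n) < e)"

definition vlimit :: "('k::real_normed_field, 'v) normed_structure \<Rightarrow> (nat \<Rightarrow> 'v) \<Rightarrow> 'v \<Rightarrow> bool" where
  "vlimit E s v \<longleftrightarrow> (\<lambda>n. vdist E (s n) v) \<longlonglongrightarrow> 0"

locale seminormed_space =
  fixes E :: "('k::{real_normed_field, banach}, 'v) normed_structure"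
  assumes zero_closed: "vzero E \<in> carrier E"
    and add_closed: "\<lbrakk>u \<in> carrier E; v \<in> carrier E\<rbrakk> \<Longrightarrow> vadd E u v \<in> carrier E"
    and scale_closed: "u \<in> carrier E \<Longrightarrow> vscale E c u \<in> carrier E"
    and add_assoc: "\<lbrakk>u \<in> carrier E; v \<in> carrier E; w \<in> carrier E\<rbrakk>
      \<Longrightarrow> vadd E (vadd E u v) w = vadd E u (vadd E v w)"
    and add_commute: "\<lbrakk>u \<in> carrier E; v \<in> carrier E\<rbrakk> \<Longrightarrow> vadd E u v = vadd E v u"
    and add_zero: "u \<in> carrier E \<Longrightarrow> vadd E u (vzero E) = u"
    and add_inverse: "u \<in> carrier E \<Longrightarrow> vadd E u (vscale E (- 1) u) = vzero E"
    and scale_add: "\<lbrakk>u \<in> carrier E; v \<in> carrier E\<rbrakk>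
      \<Longrightarrow> vscale E c (vadd E u v) = vadd E (vscale E c u) (vscale E c v)"
    and add_scale: "u \<in> carrier E \<Longrightarrow> vscale E (c + d) u = vadd E (vscale E c u) (vscale E d u)"
    and scale_scale: "u \<in> carrier E \<Longrightarrow> vscale E c (vscale E d u) = vscale E (c * d) u"
    and scale_one: "u \<in> carrier E \<Longrightarrow> vscale E 1 u = u"
    and norm_nonneg: "u \<in> carrier E \<Longrightarrow> 0 \<le> vnorm E u"
    and norm_triangle: "\<lbrakk>u \<in> carrier E; v \<in> carrier E\<rbrakk>
      \<Longrightarrow> vnorm E (vadd E u v) \<le> vnorm E u + vnorm E v"
    and norm_scale: "u \<in> carrier E \<Longrightarrow> vnorm E (vscale E c u) = norm c * vnorm E u"

locale banach_space = seminormed_space +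
  assumes norm_eq_zero: "\<lbrakk>u \<in> carrier E; vnorm E u = 0\<rbrakk> \<Longrightarrow> u = vzero E"
    and complete: "vCauchy E s \<Longrightarrow> \<exists>v\<in>carrier E. vlimit E s v"

definition dual :: "('k::real_normed_field, 'v) normed_structure \<Rightarrow> ('v \<Rightarrow> 'k) set" where
  "dual E = {f. (\<forall>u\<in>carrier E. \<forall>v\<in>carrier E. f (vadd E u v) = f u + f v) \<and>
                (\<forall>c. \<forall>u\<in>carrier E. f (vscale E c u) = c * f u) \<and>
                (\<exists>B. \<forall>u\<in>carrier E. norm (f u) \<le> B * vnorm E u)}"

definition schauder_frame ::
  "('k::real_normed_field, 'v) normed_structure \<Rightarrow> (nat \<Rightarrow> 'v) \<Rightarrow> (nat \<Rightarrow> 'v \<Rightarrow> 'k) \<Rightarrow> bool" where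
  "schauder_frame E x f \<longleftrightarrow> (\<forall>n. x n \<in> carrier E \<and> f n \<in> dual E) \<and>
     (\<forall>v\<in>carrier E. vlimit E (\<lambda>N. vsum E (map (\<lambda>n. vscale E (f n v) (x n)) [0..<N])) v)"

section \<open>Banach spaces that are types\<close>

text \<open>
  By \<open>norm_scale\<close> and completeness of the reals, \<open>sX (of_real r)\<close> is necessarily \<open>scaleR r\<close>.
\<close>

locale banach_over = vector_space sX
  for sX :: "'k::{real_normed_field, banach} \<Rightarrow> 'a::banach \<Rightarrow> 'a" +
  assumes norm_scale: "norm (sX c x) = norm c * norm x"

definition space_of :: "('k \<Rightarrow> 'a \<Rightarrow> 'a::real_normed_vector) \<Rightarrow> ('k, 'a) normed_structure" where
  "space_of sX = \<lparr>carrier = UNIV, vadd = (+), vzero = 0, vscale = sX, vnorm = norm\<rparr>"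

section \<open>Completion\<close>

definition null_rel ::
  "('k::real_normed_field, 'v) normed_structure \<Rightarrow> ((nat \<Rightarrow> 'v) \<times> (nat \<Rightarrow> 'v)) set" where
  "null_rel E = {(s, t). vCauchy E s \<and> vCauchy E t \<and> (\<lambda>n. vdist E (s n) (t n)) \<longlonglongrightarrow> 0}"

definition completion ::
  "('k::real_normed_field, 'v) normed_structure \<Rightarrow> ('k, (nat \<Rightarrow> 'v) set) normed_structure" where
  "completion E =
    \<lparr>carrier = {s. vCauchy E s} // null_rel E,
     vadd = (\<lambda>A B. \<Union>s\<in>A. \<Union>t\<in>B. null_rel E `` {\<lambda>n. vadd E (s n) (t n)}),
     vzero = null_rel E `` {\<lambda>n. vzero E},
     vscale = (\<lambda>c A. \<Union>s\<in>A. null_rel E `` {\<lambda>n. vscale E c (s n)}),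
     vnorm = (\<lambda>A. lim (\<lambda>n. vnorm E ((SOME s. s \<in> A) n)))\<rparr>"

section \<open>The projective tensor product\<close>

text \<open>
  The algebraic tensor product is the quotient of the free vector space on \<open>'a \<times> 'b\<close> by the
  subspace spanned by the bilinearity relations.
\<close>

definition free_scale :: "'k::field \<Rightarrow> ('c \<Rightarrow>\<^sub>0 'k) \<Rightarrow> ('c \<Rightarrow>\<^sub>0 'k)" where
  "free_scale c u = Poly_Mapping.map ((*) c) u"

lemma lookup_free_scale [simp]:
  "Poly_Mapping.lookup (free_scale c u) i = c * Poly_Mapping.lookup u i"
  unfolding free_scale_def by transfer (simp add: when_def)

interpretation free: vector_space free_scale
  by unfold_locales (auto intro!: poly_mapping_eqI simp: lookup_add algebra_simps)

abbreviation free_gen :: "'a \<Rightarrow> 'b \<Rightarrow> ('a \<times> 'b) \<Rightarrow>\<^sub>0 'k::field" where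
  "free_gen x y \<equiv> Poly_Mapping.single (x, y) 1"

definition bilinear_relations ::
  "('k::field \<Rightarrow> 'a::ab_group_add \<Rightarrow> 'a) \<Rightarrow> ('k \<Rightarrow> 'b::ab_group_add \<Rightarrow> 'b) \<Rightarrow> (('a \<times> 'b) \<Rightarrow>\<^sub>0 'k) set" where
  "bilinear_relations sX sY =
     {free_gen (x + x') y - (free_gen x y + free_gen x' y) | x x' y. True} \<union>
     {free_gen x (y + y') - (free_gen x y + free_gen x y') | x y y'. True} \<union>
     {free_gen (sX c x) y - free_scale c (free_gen x y) | c x y. True} \<union>
     {free_gen x (sY c y) - free_scale c (free_gen x y) | c x y. True}"

definition tensor_rel ::
  "('k::field \<Rightarrow> 'a::ab_group_add \<Rightarrow> 'a) \<Rightarrow> ('k \<Rightarrow> 'b::ab_group_add \<Rightarrow> 'b)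
    \<Rightarrow> ((('a \<times> 'b) \<Rightarrow>\<^sub>0 'k) \<times> (('a \<times> 'b) \<Rightarrow>\<^sub>0 'k)) set" where
  "tensor_rel sX sY = {(u, v). u - v \<in> free.span (bilinear_relations sX sY)}"

definition projective_norm ::
  "('k::field \<Rightarrow> 'a::real_normed_vector \<Rightarrow> 'a) \<Rightarrow> ('k \<Rightarrow> 'b::real_normed_vector \<Rightarrow> 'b)
    \<Rightarrow> (('a \<times> 'b) \<Rightarrow>\<^sub>0 'k) set \<Rightarrow> real" where
  "projective_norm sX sY U =
     Inf {(\<Sum>(x, y)\<leftarrow>ps. norm x * norm y) | ps.
            U = tensor_rel sX sY `` {\<Sum>(x, y)\<leftarrow>ps. free_gen x y}}"

definition algebraic_tensor ::
  "('k::field \<Rightarrow> 'a::real_normed_vector \<Rightarrow> 'a) \<Rightarrow> ('k \<Rightarrow> 'b::real_normed_vector \<Rightarrow> 'b)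
    \<Rightarrow> ('k, (('a \<times> 'b) \<Rightarrow>\<^sub>0 'k) set) normed_structure" where
  "algebraic_tensor sX sY =
    \<lparr>carrier = UNIV // tensor_rel sX sY,
     vadd = (\<lambda>U V. \<Union>u\<in>U. \<Union>v\<in>V. tensor_rel sX sY `` {u + v}),
     vzero = tensor_rel sX sY `` {0},
     vscale = (\<lambda>c U. \<Union>u\<in>U. tensor_rel sX sY `` {free_scale c u}),
     vnorm = projective_norm sX sY\<rparr>"

definition projective_tensor ::
  "('k::real_normed_field \<Rightarrow> 'a::real_normed_vector \<Rightarrow> 'a) \<Rightarrow> ('k \<Rightarrow> 'b::real_normed_vector \<Rightarrow> 'b)
    \<Rightarrow> ('k, (nat \<Rightarrow> (('a \<times> 'b) \<Rightarrow>\<^sub>0 'k) set) set) normed_structure" where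
  "projective_tensor sX sY = completion (algebraic_tensor sX sY)"

section \<open>Basic facts\<close>

lemma banach_over_scaleR: "banach_over (scaleR :: real \<Rightarrow> 'a::banach \<Rightarrow> 'a)"
  by unfold_locales (simp_all add: scaleR_add_right scaleR_add_left)

lemma banach_over_complex: "banach_over ((*) :: complex \<Rightarrow> complex \<Rightarrow> complex)"
  by unfold_locales (simp_all add: algebra_simps norm_mult)

lemma carrier_space_of [simp]: "carrier (space_of sX) = UNIV"
  and vadd_space_of [simp]: "vadd (space_of sX) = (+)"
  and vzero_space_of [simp]: "vzero (space_of sX) = 0"
  and vscale_space_of [simp]: "vscale (space_of sX) = sX"
  and vnorm_space_of [simp]: "vnorm (space_of sX) = norm"
  by (simp_all add: space_of_def)

context banach_over
begin

lemma scale_uminus_one: "sX (- 1) x = - x"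
  by simp

lemma vdist_space_of: "vdist (space_of sX) x y = dist x y"
  by (simp add: vdist_def dist_norm)

lemma vCauchy_space_of: "vCauchy (space_of sX) s \<longleftrightarrow> Cauchy s"
  by (simp add: vCauchy_def vdist_space_of Cauchy_def)

lemma vlimit_space_of: "vlimit (space_of sX) s x \<longleftrightarrow> s \<longlonglongrightarrow> x"
  by (simp add: vlimit_def vdist_space_of tendsto_dist_iff [symmetric])

lemma banach_space_space_of: "banach_space (space_of sX)"
proof
  show "\<exists>v\<in>carrier (space_of sX). vlimit (space_of sX) s v" if "vCauchy (space_of sX) s" for s
    using that by (simp add: vCauchy_space_of vlimit_space_of Cauchy_convergent_iff convergent_def)
qed (auto simp: algebra_simps norm_scale scale_left_distrib scale_right_distrib norm_triangle_ineq)

lemma vsum_space_of: "vsum (space_of sX) (map u [0..<N]) = (\<Sum>n<N. u n)"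
proof -
  have "vsum (space_of sX) us = sum_list us" for us
    by (induction us) (simp_all add: vsum_def)
  then show ?thesis
    by (simp add: interv_sum_list_conv_sum_set_nat atLeast0LessThan)
qed

lemma schauder_frame_space_of:
  "schauder_frame (space_of sX) x f \<longleftrightarrow>
     (\<forall>n. Vector_Spaces.linear sX (*) (f n) \<and> (\<exists>B. \<forall>v. norm (f n v) \<le> B * norm v)) \<and>
     (\<forall>v. (\<lambda>n. sX (f n v) (x n)) sums v)"
proof -
  have K: "vector_space ((*) :: 'k \<Rightarrow> 'k \<Rightarrow> 'k)"
    by unfold_locales (auto simp: algebra_simps)
  have "Vector_Spaces.linear sX (*) g \<longleftrightarrow>
      (\<forall>u v. g (u + v) = g u + g v) \<and> (\<forall>c u. g (sX c u) = c * g u)" for g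
    using K vector_space_axioms
    by (auto simp: Vector_Spaces.linear_def module_hom_def module_hom_axioms_def
        vector_space_def module_def)
  then show ?thesis
    by (simp add: schauder_frame_def dual_def vsum_space_of vlimit_space_of sums_def)
qed

end

section \<open>The algebraic tensor product is a seminormed space\<close>

lemma equiv_tensor_rel: "equiv UNIV (tensor_rel sX sY)"
proof (rule equivI)
  show "sym (tensor_rel sX sY)"
    using free.span_neg by (fastforce simp: sym_def tensor_rel_def)
  show "trans (tensor_rel sX sY)"
    using free.span_add by (fastforce simp: trans_def tensor_rel_def)
qed (auto simp: refl_on_def tensor_rel_def free.span_zero)

lemma tensor_class_eq_iff:
  "tensor_rel sX sY `` {u} = tensor_rel sX sY `` {v}
     \<longleftrightarrow> u - v \<in> free.span (bilinear_relations sX sY)"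
  using eq_equiv_class_iff [OF equiv_tensor_rel, of u v sX sY] by (simp add: tensor_rel_def)

lemma carrier_algebraic_tensor:
  "carrier (algebraic_tensor sX sY) = range (\<lambda>u. tensor_rel sX sY `` {u})"
  by (auto simp: algebraic_tensor_def quotient_def)

lemma vzero_algebraic_tensor: "vzero (algebraic_tensor sX sY) = tensor_rel sX sY `` {0}"
  by (simp add: algebraic_tensor_def)

lemma vnorm_algebraic_tensor: "vnorm (algebraic_tensor sX sY) = projective_norm sX sY"
  by (simp add: algebraic_tensor_def)

lemma vadd_algebraic_tensor:
  "vadd (algebraic_tensor sX sY) (tensor_rel sX sY `` {u}) (tensor_rel sX sY `` {v})
     = tensor_rel sX sY `` {u + v}"
proof -
  have "congruent2 (tensor_rel sX sY) (tensor_rel sX sY) (\<lambda>u v. tensor_rel sX sY `` {u + v})"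
    unfolding congruent2_def tensor_class_eq_iff
    by (auto simp: tensor_rel_def add_diff_add intro: free.span_add)
  then show ?thesis
    using UN_equiv_class2 [OF equiv_tensor_rel equiv_tensor_rel] by (simp add: algebraic_tensor_def)
qed

lemma vscale_algebraic_tensor:
  "vscale (algebraic_tensor sX sY) c (tensor_rel sX sY `` {u})
     = tensor_rel sX sY `` {free_scale c u}"
proof -
  have "congruent (tensor_rel sX sY) (\<lambda>u. tensor_rel sX sY `` {free_scale c u})"
    unfolding congruent_def tensor_class_eq_iff
    by (auto simp: tensor_rel_def free.scale_right_diff_distrib [symmetric] intro: free.span_scale)
  then show ?thesis
    using UN_equiv_class [OF equiv_tensor_rel] by (simp add: algebraic_tensor_def)
qed

lemma free_scale_sum_list: "free_scale c (sum_list us) = (\<Sum>u\<leftarrow>us. free_scale c u)"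
  by (induction us) (simp_all add: free.scale_right_distrib)

lemma tensor_class_scale_left:
  "tensor_rel sX sY `` {\<Sum>(x, y)\<leftarrow>ps. free_gen (sX c x) y}
     = tensor_rel sX sY `` {free_scale c (\<Sum>(x, y)\<leftarrow>ps. free_gen x y)}"
proof (induction ps)
  case (Cons p ps)
  obtain x y where p: "p = (x, y)" by force
  have "free_gen (sX c x) y - free_scale c (free_gen x y) \<in> free.span (bilinear_relations sX sY)"
    by (rule free.span_base) (auto simp: bilinear_relations_def)
  from free.span_add [OF this Cons.IH [unfolded tensor_class_eq_iff]]
  show ?case
    by (simp add: tensor_class_eq_iff p free.scale_right_distrib case_prod_unfold algebra_simps)
qed (simp add: tensor_class_eq_iff free.span_zero)

lemma tensor_class_sum:
  fixes sX :: "'k::field \<Rightarrow> 'a::real_normed_vector \<Rightarrow> 'a"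
    and sY :: "'k \<Rightarrow> 'b::real_normed_vector \<Rightarrow> 'b"
  shows "\<exists>ps. tensor_rel sX sY `` {u} = tensor_rel sX sY `` {\<Sum>(x, y)\<leftarrow>ps. free_gen x y}"
proof -
  let ?q = "\<lambda>u. tensor_rel sX sY `` {u}"
  have "\<exists>ps. ?q u = ?q (\<Sum>(x, y)\<leftarrow>ps. free_gen x y)" for u
  proof (induction u rule: update_induct)
    case const
    show ?case by (intro exI [of _ "[]"]) simp
  next
    case (update f k c)
    then obtain ps where ps: "?q f = ?q (\<Sum>(x, y)\<leftarrow>ps. free_gen x y)" by blast
    obtain x y where k: "k = (x, y)" by force
    have "Poly_Mapping.update k c f = free_scale c (free_gen x y) + f"
      using update(1)
      by (intro poly_mapping_eqI)
        (auto simp: k lookup_update lookup_add lookup_single when_def in_keys_iff)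
    moreover have "?q (free_scale c (free_gen x y)) = ?q (free_gen (sX c x) y)"
      using tensor_class_scale_left [of sX sY c "[(x, y)]"] by simp
    ultimately have "?q (Poly_Mapping.update k c f) = ?q (\<Sum>(x, y)\<leftarrow>(sX c x, y) # ps. free_gen x y)"
      using ps vadd_algebraic_tensor [of sX sY] by simp metis
    then show ?case by blast
  qed
  then show ?thesis .
qed

lemma projective_norm_le:
  assumes "U = tensor_rel sX sY `` {\<Sum>(x, y)\<leftarrow>ps. free_gen x y}"
  shows "projective_norm sX sY U \<le> (\<Sum>(x, y)\<leftarrow>ps. norm x * norm y)"
  unfolding projective_norm_def
proof (rule cInf_lower)
  show "bdd_below {(\<Sum>(x, y)\<leftarrow>ps. norm x * norm y) | ps.
      U = tensor_rel sX sY `` {\<Sum>(x, y)\<leftarrow>ps. free_gen x y}}"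
    by (rule bdd_belowI [of _ 0]) (auto intro!: sum_list_nonneg)
qed (use assms in blast)

lemma projective_norm_less:
  assumes "projective_norm sX sY (tensor_rel sX sY `` {u}) < e"
  obtains ps where "tensor_rel sX sY `` {u} = tensor_rel sX sY `` {\<Sum>(x, y)\<leftarrow>ps. free_gen x y}"
    and "(\<Sum>(x, y)\<leftarrow>ps. norm x * norm y) < e"
  using cInf_lessD [OF _ assms [unfolded projective_norm_def]] tensor_class_sum [of sX sY u]
  by blast

lemma projective_norm_nonneg:
  fixes sX :: "'k::field \<Rightarrow> 'a::real_normed_vector \<Rightarrow> 'a"
    and sY :: "'k \<Rightarrow> 'b::real_normed_vector \<Rightarrow> 'b"
  shows "0 \<le> projective_norm sX sY (tensor_rel sX sY `` {u})"
proof (rule ccontr)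
  assume "\<not> ?thesis"
  then obtain ps :: "('a \<times> 'b) list" where "(\<Sum>(x, y)\<leftarrow>ps. norm x * norm y) < 0"
    using projective_norm_less [of sX sY u 0] by auto
  moreover have "0 \<le> (\<Sum>(x, y)\<leftarrow>ps. norm x * norm y)"
    by (auto intro!: sum_list_nonneg)
  ultimately show False by simp
qed

lemma projective_norm_triangle:
  "projective_norm sX sY (tensor_rel sX sY `` {u + v})
     \<le> projective_norm sX sY (tensor_rel sX sY `` {u}) + projective_norm sX sY (tensor_rel sX sY `` {v})"
proof (rule field_le_epsilon)
  fix e :: real assume "0 < e"
  let ?q = "\<lambda>u. tensor_rel sX sY `` {u}"
  obtain ps where ps: "?q u = ?q (\<Sum>(x, y)\<leftarrow>ps. free_gen x y)"
      "(\<Sum>(x, y)\<leftarrow>ps. norm x * norm y) < projective_norm sX sY (?q u) + e / 2"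
    using projective_norm_less [of sX sY u "projective_norm sX sY (?q u) + e / 2"] \<open>0 < e\<close> by auto
  obtain qs where qs: "?q v = ?q (\<Sum>(x, y)\<leftarrow>qs. free_gen x y)"
      "(\<Sum>(x, y)\<leftarrow>qs. norm x * norm y) < projective_norm sX sY (?q v) + e / 2"
    using projective_norm_less [of sX sY v "projective_norm sX sY (?q v) + e / 2"] \<open>0 < e\<close> by auto
  have "?q (u + v) = ?q (\<Sum>(x, y)\<leftarrow>ps @ qs. free_gen x y)"
    using ps(1) qs(1) vadd_algebraic_tensor [of sX sY] by simp metis
  from projective_norm_le [OF this] ps(2) qs(2)
  show "projective_norm sX sY (?q (u + v))
      \<le> projective_norm sX sY (?q u) + projective_norm sX sY (?q v) + e" by simp
qed

lemma (in banach_over) projective_norm_scale: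
  "projective_norm sX sY (tensor_rel sX sY `` {free_scale c u})
     = norm c * projective_norm sX sY (tensor_rel sX sY `` {u})"
proof -
  let ?q = "\<lambda>u. tensor_rel sX sY `` {u}"
  have le: "projective_norm sX sY (?q (free_scale c u)) \<le> norm c * projective_norm sX sY (?q u)"
    for c u
  proof (rule field_le_epsilon)
    fix e :: real assume "0 < e"
    define d where "d = e / (norm c + 1)"
    have d: "0 < d" "norm c * d \<le> e"
    proof -
      have c: "0 < norm c + 1" by (simp add: add_nonneg_pos)
      show "0 < d" using \<open>0 < e\<close> c by (simp add: d_def)
      show "norm c * d \<le> e" using \<open>0 < e\<close> c by (simp add: d_def pos_divide_le_eq mult.commute)
    qed
    obtain ps where ps: "?q u = ?q (\<Sum>(x, y)\<leftarrow>ps. free_gen x y)"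
        "(\<Sum>(x, y)\<leftarrow>ps. norm x * norm y) < projective_norm sX sY (?q u) + d"
      using projective_norm_less [of sX sY u "projective_norm sX sY (?q u) + d"] d by auto
    define qs where "qs = map (\<lambda>(x, y). (sX c x, y)) ps"
    have "?q (free_scale c u) = ?q (free_scale c (\<Sum>(x, y)\<leftarrow>ps. free_gen x y))"
      using ps(1) vscale_algebraic_tensor [of sX sY c] by metis
    also have "\<dots> = ?q (\<Sum>(x, y)\<leftarrow>qs. free_gen x y)"
      using tensor_class_scale_left [of sX sY c ps] by (simp add: qs_def comp_def case_prod_unfold)
    finally have "projective_norm sX sY (?q (free_scale c u)) \<le> (\<Sum>(x, y)\<leftarrow>qs. norm x * norm y)"
      by (rule projective_norm_le)
    also have "\<dots> = norm c * (\<Sum>(x, y)\<leftarrow>ps. norm x * norm y)"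
      by (simp add: qs_def comp_def case_prod_unfold norm_scale sum_list_const_mult mult.assoc)
    also have "\<dots> \<le> norm c * (projective_norm sX sY (?q u) + d)"
      using ps(2) by (intro mult_left_mono) auto
    also have "\<dots> \<le> norm c * projective_norm sX sY (?q u) + e"
      using d by (simp add: algebra_simps)
    finally show "projective_norm sX sY (?q (free_scale c u))
        \<le> norm c * projective_norm sX sY (?q u) + e" .
  qed
  show ?thesis
  proof (cases "c = 0")
    case True
    then show ?thesis
      using le [of 0 u] projective_norm_nonneg [of sX sY "free_scale 0 u"] by simp
  next
    case False
    from False have "projective_norm sX sY (?q u) \<le> inverse (norm c) * projective_norm sX sY (?q (free_scale c u))"
      using le [of "inverse c" "free_scale c u"] by (simp add: norm_inverse)
    with False have "norm c * projective_norm sX sY (?q u) \<le> projective_norm sX sY (?q (free_scale c u))"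
      by (simp add: field_simps)
    with le [of c u] show ?thesis by simp
  qed
qed

text \<open>
  Norms on the algebraic tensor product are only used through \<open>seminormed_space\<close>: that \<open>\<pi>\<close> is
  definite needs separating functionals, and \<open>completion\<close> identifies elements at distance zero.
\<close>

lemma seminormed_space_algebraic_tensor:
  assumes "banach_over sX"
  shows "seminormed_space (algebraic_tensor sX sY)"
  by unfold_locales
    (auto simp: carrier_algebraic_tensor vadd_algebraic_tensor vscale_algebraic_tensor
      vzero_algebraic_tensor vnorm_algebraic_tensor projective_norm_nonneg projective_norm_triangle
      banach_over.projective_norm_scale [OF assms] algebra_simps
      free.scale_right_distrib free.scale_left_distrib)

section \<open>The completion is a Banach space\<close>

lemma null_sandwich:
  fixes f g :: "nat \<Rightarrow> real"
  assumes "g \<longlonglongrightarrow> 0" "\<And>n. 0 \<le> f n" "\<And>n. f n \<le> g n"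
  shows "f \<longlonglongrightarrow> 0"
  by (rule tendsto_sandwich [OF _ _ tendsto_const assms(1)]) (simp_all add: assms)

context seminormed_space
begin

lemma vdist_nonneg: "\<lbrakk>u \<in> carrier E; v \<in> carrier E\<rbrakk> \<Longrightarrow> 0 \<le> vdist E u v"
  by (simp add: vdist_def norm_nonneg add_closed scale_closed)

lemma scale_zero_left: "u \<in> carrier E \<Longrightarrow> vscale E 0 u = vzero E"
  using add_scale [of u 1 "- 1"] by (simp add: scale_one add_inverse)

lemma norm_zero: "vnorm E (vzero E) = 0"
  using norm_scale [OF zero_closed, of 0] by (simp add: scale_zero_left zero_closed)

lemma scale_zero_right: "vscale E c (vzero E) = vzero E"
  using scale_scale [OF zero_closed, of c 0] by (simp add: scale_zero_left zero_closed)

lemma vdist_self: "u \<in> carrier E \<Longrightarrow> vdist E u u = 0"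
  by (simp add: vdist_def add_inverse norm_zero)

lemma add_left_commute: "\<lbrakk>u \<in> carrier E; v \<in> carrier E; w \<in> carrier E\<rbrakk>
    \<Longrightarrow> vadd E u (vadd E v w) = vadd E v (vadd E u w)"
  by (metis add_assoc add_commute)

lemmas vs = add_closed scale_closed zero_closed add_assoc add_commute add_left_commute
  scale_add scale_scale scale_one

lemma add_inverse_left: "\<lbrakk>u \<in> carrier E; v \<in> carrier E\<rbrakk> \<Longrightarrow> vadd E u (vadd E (vscale E (- 1) u) v) = v"
  by (metis add_assoc add_inverse add_commute add_zero scale_closed zero_closed)

lemma vdist_commute: "\<lbrakk>u \<in> carrier E; v \<in> carrier E\<rbrakk> \<Longrightarrow> vdist E u v = vdist E v u"
  using norm_scale [of "vadd E u (vscale E (- 1) v)" "- 1"]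
  by (simp add: vdist_def vs)

lemma vdist_triangle:
  assumes "u \<in> carrier E" "v \<in> carrier E" "w \<in> carrier E"
  shows "vdist E u w \<le> vdist E u v + vdist E v w"
proof -
  have "vadd E u (vscale E (- 1) w)
      = vadd E (vadd E u (vscale E (- 1) v)) (vadd E v (vscale E (- 1) w))"
  proof -
    have "vadd E v (vadd E (vscale E (- 1) v) (vscale E (- 1) w)) = vscale E (- 1) w"
      using assms by (intro add_inverse_left) (auto intro: vs)
    then show ?thesis using assms
      by (metis add_assoc add_left_commute add_closed scale_closed)
  qed
  then show ?thesis
    using norm_triangle [of "vadd E u (vscale E (- 1) v)" "vadd E v (vscale E (- 1) w)"] assms
    by (simp add: vdist_def vs(1,2))
qed

lemma vdist_add:
  assumes "u \<in> carrier E" "v \<in> carrier E" "u' \<in> carrier E" "v' \<in> carrier E"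
  shows "vdist E (vadd E u v) (vadd E u' v') \<le> vdist E u u' + vdist E v v'"
proof -
  have "vadd E (vadd E u v) (vscale E (- 1) (vadd E u' v'))
      = vadd E (vadd E u (vscale E (- 1) u')) (vadd E v (vscale E (- 1) v'))"
    using assms by (simp add: vs)
  then show ?thesis
    using norm_triangle [of "vadd E u (vscale E (- 1) u')" "vadd E v (vscale E (- 1) v')"] assms
    by (simp add: vdist_def vs(1,2))
qed

lemma vdist_scale:
  assumes "u \<in> carrier E" "v \<in> carrier E"
  shows "vdist E (vscale E c u) (vscale E c v) = norm c * vdist E u v"
  using norm_scale [of "vadd E u (vscale E (- 1) v)" c] assms
  by (simp add: vdist_def vs)

lemma vdist_zero: "u \<in> carrier E \<Longrightarrow> vdist E u (vzero E) = vnorm E u"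
  by (simp add: vdist_def scale_zero_right add_zero)

lemma norm_diff_le:
  assumes "u \<in> carrier E" "v \<in> carrier E"
  shows "\<bar>vnorm E u - vnorm E v\<bar> \<le> vdist E u v"
  using vdist_triangle [of u v "vzero E"] vdist_triangle [of v u "vzero E"] assms
  by (simp add: vdist_zero zero_closed vdist_commute)

lemma vCauchyI:
  assumes "\<And>n. s n \<in> carrier E" and "\<And>e. 0 < e \<Longrightarrow> \<exists>M. \<forall>m\<ge>M. \<forall>n\<ge>M. vdist E (s m) (s n) < e"
  shows "vCauchy E s"
  using assms by (auto simp: vCauchy_def)

lemma vCauchy_closed: "vCauchy E s \<Longrightarrow> s n \<in> carrier E"
  by (simp add: vCauchy_def)

lemma vCauchyD: "\<lbrakk>vCauchy E s; 0 < e\<rbrakk> \<Longrightarrow> \<exists>M. \<forall>m\<ge>M. \<forall>n\<ge>M. vdist E (s m) (s n) < e"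
  by (simp add: vCauchy_def)

lemma vCauchy_const: "u \<in> carrier E \<Longrightarrow> vCauchy E (\<lambda>n. u)"
  by (simp add: vCauchy_def vdist_self)

lemma vCauchy_add:
  assumes s: "vCauchy E s" and t: "vCauchy E t"
  shows "vCauchy E (\<lambda>n. vadd E (s n) (t n))"
proof (rule vCauchyI)
  fix e :: real assume "0 < e"
  then obtain M N where M: "\<forall>m\<ge>M. \<forall>n\<ge>M. vdist E (s m) (s n) < e / 2"
    and N: "\<forall>m\<ge>N. \<forall>n\<ge>N. vdist E (t m) (t n) < e / 2"
    using vCauchyD [OF s, of "e / 2"] vCauchyD [OF t, of "e / 2"] by auto
  have "vdist E (vadd E (s m) (t m)) (vadd E (s n) (t n)) < e"
    if "max M N \<le> m" "max M N \<le> n" for m n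
  proof -
    have "vdist E (s m) (s n) < e / 2" "vdist E (t m) (t n) < e / 2" using M N that by auto
    then show ?thesis
      using vdist_add [of "s m" "t m" "s n" "t n"] s t by (simp add: vCauchy_closed)
  qed
  then show "\<exists>M. \<forall>m\<ge>M. \<forall>n\<ge>M. vdist E (vadd E (s m) (t m)) (vadd E (s n) (t n)) < e" by blast
qed (use assms in \<open>simp add: vCauchy_closed add_closed\<close>)

lemma vCauchy_scale:
  assumes s: "vCauchy E s"
  shows "vCauchy E (\<lambda>n. vscale E c (s n))"
proof (rule vCauchyI)
  fix e :: real assume "0 < e"
  then obtain M where M: "\<forall>m\<ge>M. \<forall>n\<ge>M. vdist E (s m) (s n) < e / (norm c + 1)"
    using vCauchyD [OF s, of "e / (norm c + 1)"] by (auto simp: add_nonneg_pos)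
  have "vdist E (vscale E c (s m)) (vscale E c (s n)) < e" if "M \<le> m" "M \<le> n" for m n
  proof -
    have d: "vdist E (s m) (s n) < e / (norm c + 1)" using M that by auto
    have "norm c * vdist E (s m) (s n) \<le> (norm c + 1) * vdist E (s m) (s n)"
      using s by (intro mult_right_mono) (auto simp: vCauchy_closed vdist_nonneg)
    also have "\<dots> < e" using d by (simp add: pos_less_divide_eq add_nonneg_pos mult.commute)
    finally show ?thesis using s by (simp add: vdist_scale vCauchy_closed)
  qed
  then show "\<exists>M. \<forall>m\<ge>M. \<forall>n\<ge>M. vdist E (vscale E c (s m)) (vscale E c (s n)) < e" by blast
qed (use assms in \<open>simp add: vCauchy_closed scale_closed\<close>)

lemma equiv_null_rel: "equiv {s. vCauchy E s} (null_rel E)"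
proof (rule equivI)
  show "refl_on {s. vCauchy E s} (null_rel E)"
    by (auto simp: refl_on_def null_rel_def vdist_self vCauchy_closed)
  show "null_rel E \<subseteq> {s. vCauchy E s} \<times> {s. vCauchy E s}"
    by (auto simp: null_rel_def)
  show "sym (null_rel E)"
    by (auto simp: sym_def null_rel_def vdist_commute vCauchy_closed)
  show "trans (null_rel E)"
  proof (rule transI)
    fix s t r assume st: "(s, t) \<in> null_rel E" and tr: "(t, r) \<in> null_rel E"
    then have c: "vCauchy E s" "vCauchy E t" "vCauchy E r" by (auto simp: null_rel_def)
    have "(\<lambda>n. vdist E (s n) (t n) + vdist E (t n) (r n)) \<longlonglongrightarrow> 0"
      using st tr by (intro tendsto_add_zero) (auto simp: null_rel_def)
    then have "(\<lambda>n. vdist E (s n) (r n)) \<longlonglongrightarrow> 0"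
      by (rule null_sandwich) (intro vdist_nonneg vdist_triangle c [THEN vCauchy_closed])+
    with c show "(s, r) \<in> null_rel E" by (simp add: null_rel_def)
  qed
qed

lemma null_class_eq_iff:
  "\<lbrakk>vCauchy E s; vCauchy E t\<rbrakk>
    \<Longrightarrow> null_rel E `` {s} = null_rel E `` {t} \<longleftrightarrow> (\<lambda>n. vdist E (s n) (t n)) \<longlonglongrightarrow> 0"
  using eq_equiv_class_iff [OF equiv_null_rel, of s t] by (simp add: null_rel_def)

lemma carrier_completion:
  "carrier (completion E) = (\<lambda>s. null_rel E `` {s}) ` {s. vCauchy E s}"
  by (auto simp: completion_def quotient_def)

lemma vzero_completion: "vzero (completion E) = null_rel E `` {\<lambda>n. vzero E}"
  by (simp add: completion_def)

lemma vadd_completion: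
  assumes "vCauchy E s" "vCauchy E t"
  shows "vadd (completion E) (null_rel E `` {s}) (null_rel E `` {t})
     = null_rel E `` {\<lambda>n. vadd E (s n) (t n)}"
proof -
  have "congruent2 (null_rel E) (null_rel E) (\<lambda>s t. null_rel E `` {\<lambda>n. vadd E (s n) (t n)})"
  proof -
    have "null_rel E `` {\<lambda>n. vadd E (s n) (t n)} = null_rel E `` {\<lambda>n. vadd E (s' n) (t' n)}"
      if a: "(s, s') \<in> null_rel E" and b: "(t, t') \<in> null_rel E" for s t s' t'
    proof -
      have c: "vCauchy E s" "vCauchy E t" "vCauchy E s'" "vCauchy E t'"
        using that by (auto simp: null_rel_def)
      have "(\<lambda>n. vdist E (s n) (s' n) + vdist E (t n) (t' n)) \<longlonglongrightarrow> 0"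
        using that by (intro tendsto_add_zero) (auto simp: null_rel_def)
      then have "(\<lambda>n. vdist E (vadd E (s n) (t n)) (vadd E (s' n) (t' n))) \<longlonglongrightarrow> 0"
        by (rule null_sandwich) (intro vdist_nonneg vdist_add add_closed c [THEN vCauchy_closed])+
      with c show ?thesis by (simp add: null_class_eq_iff vCauchy_add)
    qed
    then show ?thesis unfolding congruent2_def by blast
  qed
  then show ?thesis
    using UN_equiv_class2 [OF equiv_null_rel equiv_null_rel] assms by (simp add: completion_def)
qed

lemma vscale_completion:
  assumes "vCauchy E s"
  shows "vscale (completion E) c (null_rel E `` {s}) = null_rel E `` {\<lambda>n. vscale E c (s n)}"
proof -
  have "congruent (null_rel E) (\<lambda>s. null_rel E `` {\<lambda>n. vscale E c (s n)})"
  proof -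
    have "null_rel E `` {\<lambda>n. vscale E c (s n)} = null_rel E `` {\<lambda>n. vscale E c (s' n)}"
      if a: "(s, s') \<in> null_rel E" for s s'
    proof -
      have c: "vCauchy E s" "vCauchy E s'" and "(\<lambda>n. vdist E (s n) (s' n)) \<longlonglongrightarrow> 0"
        using that by (auto simp: null_rel_def)
      then have "(\<lambda>n. norm c * vdist E (s n) (s' n)) \<longlonglongrightarrow> 0"
        by (intro tendsto_mult_right_zero)
      with c show ?thesis
        by (simp add: null_class_eq_iff vCauchy_scale vdist_scale vCauchy_closed)
    qed
    then show ?thesis unfolding congruent_def by blast
  qed
  then show ?thesis
    using UN_equiv_class [OF equiv_null_rel] assms by (simp add: completion_def)
qed

lemma vnorm_convergent:
  assumes "vCauchy E s"
  shows "convergent (\<lambda>n. vnorm E (s n))"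
proof -
  have "Cauchy (\<lambda>n. vnorm E (s n))"
  proof (rule metric_CauchyI)
    fix e :: real assume "0 < e"
    then obtain M where "\<forall>m\<ge>M. \<forall>n\<ge>M. vdist E (s m) (s n) < e"
      using vCauchyD [OF assms] by blast
    then have M: "vdist E (s m) (s n) < e" if "M \<le> m" "M \<le> n" for m n
      using that by blast
    have "dist (vnorm E (s m)) (vnorm E (s n)) < e" if "M \<le> m" "M \<le> n" for m n
      using norm_diff_le [of "s m" "s n"] M [OF that] assms
      by (simp add: dist_real_def vCauchy_closed)
    then show "\<exists>M. \<forall>m\<ge>M. \<forall>n\<ge>M. dist (vnorm E (s m)) (vnorm E (s n)) < e" by blast
  qed
  then show ?thesis by (rule Cauchy_convergent)
qed

lemma vnorm_completion:
  assumes s: "vCauchy E s"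
  shows "(\<lambda>n. vnorm E (s n)) \<longlonglongrightarrow> vnorm (completion E) (null_rel E `` {s})"
proof -
  define t where "t = (SOME t. t \<in> null_rel E `` {s})"
  have "s \<in> null_rel E `` {s}"
    using s equiv_class_self [OF equiv_null_rel] by simp
  then have "t \<in> null_rel E `` {s}" unfolding t_def by (rule someI [of "\<lambda>t. t \<in> null_rel E `` {s}"])
  then have t: "vCauchy E t" and st: "(\<lambda>n. vdist E (s n) (t n)) \<longlonglongrightarrow> 0"
    by (auto simp: null_rel_def)
  have "(\<lambda>n. vnorm E (t n)) \<longlonglongrightarrow> lim (\<lambda>n. vnorm E (t n))"
    using vnorm_convergent [OF t] by (simp add: convergent_LIMSEQ_iff)
  moreover have "(\<lambda>n. vnorm E (s n) - vnorm E (t n)) \<longlonglongrightarrow> 0"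
    by (rule Lim_null_comparison [OF _ st])
      (use s t in \<open>auto simp: norm_diff_le vCauchy_closed\<close>)
  ultimately have "(\<lambda>n. vnorm E (s n) - vnorm E (t n) + vnorm E (t n))
      \<longlonglongrightarrow> 0 + lim (\<lambda>n. vnorm E (t n))"
    by (intro tendsto_add)
  then show ?thesis by (simp add: completion_def t_def)
qed

lemma vnorm_completion_eq:
  "\<lbrakk>vCauchy E s; (\<lambda>n. vnorm E (s n)) \<longlonglongrightarrow> r\<rbrakk> \<Longrightarrow> vnorm (completion E) (null_rel E `` {s}) = r"
  using vnorm_completion LIMSEQ_unique by blast

lemma seminormed_space_completion: "seminormed_space (completion E)"
proof
  fix U V W :: "(nat \<Rightarrow> 'v) set" and c d :: 'k
  let ?k = "\<lambda>s. null_rel E `` {s}"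
  note simps = vzero_completion vadd_completion vscale_completion vCauchy_add vCauchy_scale
    vCauchy_const zero_closed
  show "vzero (completion E) \<in> carrier (completion E)"
    by (auto simp: carrier_completion simps)
  assume "U \<in> carrier (completion E)"
  then obtain s where s: "U = ?k s" "vCauchy E s" "\<And>n. s n \<in> carrier E" using vCauchy_closed by (auto simp: carrier_completion)
  show "vscale (completion E) c U \<in> carrier (completion E)"
    using s by (auto simp: carrier_completion simps)
  show "vadd (completion E) U (vzero (completion E)) = U"
    using s by (simp add: simps add_zero)
  show "vadd (completion E) U (vscale (completion E) (- 1) U) = vzero (completion E)"
    using s by (simp add: simps add_inverse)
  show "vscale (completion E) (c + d) U
      = vadd (completion E) (vscale (completion E) c U) (vscale (completion E) d U)"
    using s by (simp add: simps add_scale)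
  show "vscale (completion E) c (vscale (completion E) d U) = vscale (completion E) (c * d) U"
    using s by (simp add: simps scale_scale)
  show "vscale (completion E) 1 U = U"
    using s by (simp add: simps scale_one)
  show "0 \<le> vnorm (completion E) U"
    using s vnorm_completion [of s]
    by (auto intro!: LIMSEQ_le_const simp: norm_nonneg)
  show "vnorm (completion E) (vscale (completion E) c U) = norm c * vnorm (completion E) U"
    using s vnorm_completion [of s]
    by (auto simp: simps norm_scale intro!: vnorm_completion_eq tendsto_mult_left)
  assume "V \<in> carrier (completion E)"
  then obtain t where t: "V = ?k t" "vCauchy E t" "\<And>n. t n \<in> carrier E" using vCauchy_closed by (auto simp: carrier_completion)
  show "vadd (completion E) U V \<in> carrier (completion E)"
    using s t by (auto simp: carrier_completion simps)
  show "vadd (completion E) U V = vadd (completion E) V U"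
    using s t by (simp add: simps add_commute)
  show "vscale (completion E) c (vadd (completion E) U V)
      = vadd (completion E) (vscale (completion E) c U) (vscale (completion E) c V)"
    using s t by (simp add: simps scale_add)
  show "vnorm (completion E) (vadd (completion E) U V)
      \<le> vnorm (completion E) U + vnorm (completion E) V"
  proof (rule LIMSEQ_le)
    show "(\<lambda>n. vnorm E (vadd E (s n) (t n))) \<longlonglongrightarrow> vnorm (completion E) (vadd (completion E) U V)"
      using vnorm_completion [OF vCauchy_add [OF s(2) t(2)]] s t by (simp add: simps)
    show "(\<lambda>n. vnorm E (s n) + vnorm E (t n))
        \<longlonglongrightarrow> vnorm (completion E) U + vnorm (completion E) V"
      using vnorm_completion [OF s(2)] vnorm_completion [OF t(2)] s t by (simp add: tendsto_add)
  qed (use s t in \<open>auto simp: norm_triangle\<close>)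
  assume "W \<in> carrier (completion E)"
  then obtain r where r: "W = ?k r" "vCauchy E r" "\<And>n. r n \<in> carrier E" using vCauchy_closed by (auto simp: carrier_completion)
  show "vadd (completion E) (vadd (completion E) U V) W
      = vadd (completion E) U (vadd (completion E) V W)"
    using s t r by (simp add: simps add_assoc)
qed

lemma vdist_completion:
  assumes "vCauchy E s" "vCauchy E t"
  shows "(\<lambda>n. vdist E (s n) (t n)) \<longlonglongrightarrow> vdist (completion E) (null_rel E `` {s}) (null_rel E `` {t})"
  using vnorm_completion [OF vCauchy_add [OF assms(1) vCauchy_scale [OF assms(2), of "- 1"]]] assms
  by (simp add: vdist_def vadd_completion vscale_completion vCauchy_scale)

definition embed :: "'v \<Rightarrow> (nat \<Rightarrow> 'v) set" where
  "embed u = null_rel E `` {\<lambda>n. u}"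

lemma embed_closed: "u \<in> carrier E \<Longrightarrow> embed u \<in> carrier (completion E)"
  by (auto simp: embed_def carrier_completion vCauchy_const)

lemma embed_add: "\<lbrakk>u \<in> carrier E; v \<in> carrier E\<rbrakk>
    \<Longrightarrow> embed (vadd E u v) = vadd (completion E) (embed u) (embed v)"
  by (simp add: embed_def vadd_completion vCauchy_const)

lemma embed_scale: "u \<in> carrier E \<Longrightarrow> embed (vscale E c u) = vscale (completion E) c (embed u)"
  by (simp add: embed_def vscale_completion vCauchy_const)

lemma embed_norm: "u \<in> carrier E \<Longrightarrow> vnorm (completion E) (embed u) = vnorm E u"
  by (simp add: embed_def vnorm_completion_eq vCauchy_const)

lemma embed_tendsto:
  assumes s: "vCauchy E s"
  shows "vlimit (completion E) (\<lambda>m. embed (s m)) (null_rel E `` {s})"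
  unfolding vlimit_def
proof (rule LIMSEQ_I)
  fix e :: real assume "0 < e"
  then obtain M where M: "\<forall>m\<ge>M. \<forall>n\<ge>M. vdist E (s m) (s n) < e / 2"
    using vCauchyD [OF s, of "e / 2"] by auto
  interpret C: seminormed_space "completion E" by (rule seminormed_space_completion)
  have "norm (vdist (completion E) (embed (s m)) (null_rel E `` {s}) - 0) < e" if "M \<le> m" for m
  proof -
    have "(\<lambda>n. vdist E (s m) (s n)) \<longlonglongrightarrow> vdist (completion E) (embed (s m)) (null_rel E `` {s})"
      unfolding embed_def using s by (intro vdist_completion) (auto simp: vCauchy_const vCauchy_closed)
    then have "vdist (completion E) (embed (s m)) (null_rel E `` {s}) \<le> e / 2"
    proof (rule LIMSEQ_le_const2)
      have "vdist E (s m) (s n) \<le> e / 2" if "M \<le> n" for n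
        using M \<open>M \<le> m\<close> that by (simp add: less_imp_le)
      then show "\<exists>N. \<forall>n\<ge>N. vdist E (s m) (s n) \<le> e / 2" by blast
    qed
    moreover have "0 \<le> vdist (completion E) (embed (s m)) (null_rel E `` {s})"
      using s by (intro C.vdist_nonneg embed_closed) (auto simp: carrier_completion vCauchy_closed)
    ultimately show ?thesis using \<open>0 < e\<close> by simp
  qed
  then show "\<exists>M. \<forall>m\<ge>M. norm (vdist (completion E) (embed (s m)) (null_rel E `` {s}) - 0) < e" by blast
qed

theorem banach_space_completion: "banach_space (completion E)"
proof -
  interpret C: seminormed_space "completion E" by (rule seminormed_space_completion)
  show ?thesis
  proof
    fix U assume "U \<in> carrier (completion E)" and 0: "vnorm (completion E) U = 0"
    then obtain s where s: "U = null_rel E `` {s}" "vCauchy E s" by (auto simp: carrier_completion)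
    then have "(\<lambda>n. vdist E (s n) (vzero E)) \<longlonglongrightarrow> 0"
      using vnorm_completion [of s] 0 by (simp add: vdist_zero vCauchy_closed)
    then show "U = vzero (completion E)"
      using s by (simp add: vzero_completion null_class_eq_iff vCauchy_const zero_closed)
  next
    fix S assume S: "vCauchy (completion E) S"
    have "\<exists>u\<in>carrier E. vdist (completion E) (embed u) (S j) < 1 / real (Suc j)" for j
    proof -
      have "S j \<in> carrier (completion E)" using S by (simp add: C.vCauchy_closed)
      then obtain s where s: "S j = null_rel E `` {s}" "vCauchy E s"
        by (auto simp: carrier_completion)
      have "\<forall>\<^sub>F m in sequentially. vdist (completion E) (embed (s m)) (S j) < 1 / real (Suc j)"
        using embed_tendsto [OF s(2)] s(1) by (intro order_tendstoD(2) [of _ 0]) (auto simp: vlimit_def)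
      then obtain m where "vdist (completion E) (embed (s m)) (S j) < 1 / real (Suc j)"
        by (auto simp: eventually_sequentially)
      with s show ?thesis by (auto simp: vCauchy_closed)
    qed
    then obtain t where t: "\<And>j. t j \<in> carrier E"
      and tS: "\<And>j. vdist (completion E) (embed (t j)) (S j) < 1 / real (Suc j)" by metis
    have tS0: "(\<lambda>j. vdist (completion E) (embed (t j)) (S j)) \<longlonglongrightarrow> 0"
      using LIMSEQ_inverse_real_of_nat
      by (rule null_sandwich)
        (intro C.vdist_nonneg embed_closed t C.vCauchy_closed [OF S],
          use tS in \<open>simp add: inverse_eq_divide less_imp_le\<close>)
    have emb: "vdist (completion E) (embed u) (embed v) = vdist E u v"
      if "u \<in> carrier E" "v \<in> carrier E" for u v
      using that by (simp add: vdist_def embed_scale [symmetric] embed_add [symmetric] embed_norm vs(1,2))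
    have tC: "vCauchy E t"
    proof (rule vCauchyI)
      fix e :: real assume "0 < e"
      then obtain M where M: "\<forall>m\<ge>M. \<forall>n\<ge>M. vdist (completion E) (S m) (S n) < e / 3"
        using C.vCauchyD [OF S, of "e / 3"] by auto
      obtain N where N: "\<forall>m\<ge>N. vdist (completion E) (embed (t m)) (S m) < e / 3"
        using order_tendstoD(2) [OF tS0, of "e / 3"] \<open>0 < e\<close> by (auto simp: eventually_sequentially)
      have "vdist E (t m) (t n) < e" if "max M N \<le> m" "max M N \<le> n" for m n
      proof -
        note cl = t embed_closed C.vCauchy_closed [OF S]
        have "vdist E (t m) (t n) \<le> vdist (completion E) (embed (t m)) (S m)
            + vdist (completion E) (S m) (embed (t n))"
          using C.vdist_triangle [of "embed (t m)" "S m" "embed (t n)"] cl by (simp add: emb)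
        also have "\<dots> \<le> vdist (completion E) (embed (t m)) (S m)
            + (vdist (completion E) (S m) (S n) + vdist (completion E) (embed (t n)) (S n))"
          using C.vdist_triangle [of "S m" "S n" "embed (t n)"] cl by (simp add: C.vdist_commute)
        also have "\<dots> < e / 3 + (e / 3 + e / 3)"
          using M N that by (intro add_strict_mono) auto
        finally show ?thesis by simp
      qed
      then show "\<exists>M. \<forall>m\<ge>M. \<forall>n\<ge>M. vdist E (t m) (t n) < e" by blast
    qed (rule t)
    have T: "null_rel E `` {t} \<in> carrier (completion E)"
      using tC by (auto simp: carrier_completion)
    have "(\<lambda>j. vdist (completion E) (embed (t j)) (S j)
        + vdist (completion E) (embed (t j)) (null_rel E `` {t})) \<longlonglongrightarrow> 0"
      using embed_tendsto [OF tC] by (intro tendsto_add_zero tS0) (simp add: vlimit_def)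
    then have "(\<lambda>j. vdist (completion E) (S j) (null_rel E `` {t})) \<longlonglongrightarrow> 0"
    proof (rule null_sandwich)
      fix j
      note cl = T embed_closed [OF t, of j] C.vCauchy_closed [OF S, of j]
      show "0 \<le> vdist (completion E) (S j) (null_rel E `` {t})"
        by (intro C.vdist_nonneg cl)
      show "vdist (completion E) (S j) (null_rel E `` {t})
          \<le> vdist (completion E) (embed (t j)) (S j)
            + vdist (completion E) (embed (t j)) (null_rel E `` {t})"
        using C.vdist_triangle [of "S j" "embed (t j)" "null_rel E `` {t}"]
          C.vdist_commute [of "S j" "embed (t j)"] cl by simp
    qed
    then have "vlimit (completion E) S (null_rel E `` {t})"
      by (simp add: vlimit_def)
    with T show "\<exists>v\<in>carrier (completion E). vlimit (completion E) S v" by blast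
  qed
qed

end

theorem banach_space_projective_tensor:
  assumes "banach_over sX"
  shows "banach_space (projective_tensor sX sY)"
  unfolding projective_tensor_def
  by (intro seminormed_space.banach_space_completion seminormed_space_algebraic_tensor assms)

end

theory Submission
  imports Defs "HOL-Library.Discrete_Functions"
begin

text \<open>
  Let \<open>(x\<^sub>i, f\<^sub>i)\<close> and \<open>(y\<^sub>j, g\<^sub>j)\<close> be Schauder frames with partial sum operators
  \<open>S\<^sub>n\<close> on \<open>X\<close> and \<open>T\<^sub>n\<close> on \<open>Y\<close>.  The frame of the tensor product consists of the pairs
  \<open>(x\<^sub>i \<otimes> y\<^sub>j, f\<^sub>i \<otimes> g\<^sub>j)\<close>, enumerated along growing squares, as in Gelbaum and Gil de Lamadrid's
  theorem on tensor products of Schauder bases.  In this order the first \<open>N = n\<^sup>2 + r\<close> pairs,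
  \<open>0 \<le> r \<le> 2 n\<close>, consist of a full square and parts of one new row and one new column, so that the
  partial sum operator of the product is
    \<open>P\<^sub>N = S\<^sub>n \<otimes> T\<^sub>n + (S\<^sub>n\<^sub>+\<^sub>1 - S\<^sub>n) \<otimes> T\<^sub>p + S\<^sub>q \<otimes> (T\<^sub>n\<^sub>+\<^sub>1 - T\<^sub>n)\<close>
  with \<open>p = min r n\<close> and \<open>q = max 0 (r - n)\<close> (\<open>square_partial_sum\<close>).

  Two facts follow from this formula.  By the uniform boundedness principle \<open>\<parallel>S\<^sub>n\<parallel> \<le> C\<close> and
  \<open>\<parallel>T\<^sub>n\<parallel> \<le> D\<close> for all \<open>n\<close>, hence \<open>\<parallel>P\<^sub>N\<parallel> \<le> 5 C D\<close>.  On an elementary tensor \<open>x \<otimes> y\<close> the first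
  summand tends to \<open>x \<otimes> y\<close>, while the other two tend to zero, because the terms of the convergent
  series \<open>\<Sum> f\<^sub>i(x) x\<^sub>i\<close> and \<open>\<Sum> g\<^sub>j(y) y\<^sub>j\<close> do.  By linearity \<open>P\<^sub>N u\<close> tends to \<open>u\<close> for every \<open>u\<close> of
  the algebraic tensor product (\<open>schauder_frame_algebraic_expansion\<close>).  Uniformly bounded operators
  that converge to the identity on a dense subspace converge to it everywhere, which carries the
  expansion over to the completion (\<open>schauder_frame_completion\<close>).

  Calculations with tensors are done on representatives in the free vector space, where the
  projective norm becomes a seminorm \<open>\<pi>\<close> that is constant on classes.
\<close>

section \<open>Partial sums of a Schauder frame\<close>

text \<open>
  The Banach--Steinhaus theorem, by the Baire category theorem applied to the closed sets
  \<open>{x. \<forall>n. norm (T n x) \<le> m}\<close>.  Homogeneity of \<open>norm (T n x)\<close> in the scalars \<open>'k\<close> is all that is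
  asked, since the codomain has no scalar multiplication by \<open>'k\<close> attached to it.
\<close>

lemma (in banach_over) uniform_boundedness:
  fixes T :: "nat \<Rightarrow> 'a \<Rightarrow> 'c::real_normed_vector"
  assumes add: "\<And>n x y. T n (x + y) = T n x + T n y"
    and scale: "\<And>n c x. norm (T n (sX c x)) = norm c * norm (T n x)"
    and cont: "\<And>n. \<exists>B. \<forall>x. norm (T n x) \<le> B * norm x"
    and pointwise: "\<And>x. Bseq (\<lambda>n. T n x)"
  obtains C where "0 \<le> C" and "\<And>n x. norm (T n x) \<le> C * norm x"
proof -
  have diff: "T n (x - y) = T n x - T n y" for n x y
    using add [of n "x - y" y] by simp
  \<comment> \<open>By pointwise boundedness these sets cover the space, so one of them contains a ball.\<close>
  define F where "F m = {x. \<forall>n. norm (T n x) \<le> real m}" for m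
  have cont_T: "continuous_on UNIV (T n)" for n
  proof -
    obtain B where B: "norm (T n x) \<le> B * norm x" for x using cont by blast
    have "dist (T n x) (T n y) \<le> \<bar>B\<bar> * dist x y" for x y
    proof -
      have "dist (T n x) (T n y) \<le> B * norm (x - y)"
        using B [of "x - y"] by (simp add: dist_norm diff)
      also have "\<dots> \<le> \<bar>B\<bar> * dist x y" by (simp add: dist_norm mult_right_mono)
      finally show ?thesis .
    qed
    then have "\<bar>B\<bar>-lipschitz_on UNIV (T n)" by (intro lipschitz_onI) auto
    then show ?thesis by (rule lipschitz_on_continuous_on)
  qed
  have closed: "closed (F m)" for m
    unfolding F_def by (intro closed_Collect_all closed_Collect_le continuous_intros cont_T)
  have cover: "(\<Union>m. F m) = UNIV"
  proof -
    have "\<exists>m. x \<in> F m" for x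
    proof -
      obtain K where K: "\<And>n. norm (T n x) \<le> K" using pointwise [of x] by (auto simp: Bseq_def)
      obtain m where "K \<le> real m" using real_arch_simple by blast
      with K show ?thesis unfolding F_def by (blast intro: order_trans)
    qed
    then show ?thesis by blast
  qed
  have "\<exists>m. interior (F m) \<noteq> {}"
  proof (rule ccontr)
    assume "\<not> ?thesis"
    then have "euclidean interior_of \<Union>(range F) = {}"
      using closed
      by (intro Baire_category_alt disjI1 completely_metrizable_space_euclidean) auto
    with cover show False by simp
  qed
  then obtain m x0 r where r: "0 < r" and ball: "ball x0 r \<subseteq> F m"
    by (auto simp: mem_interior)
  \<comment> \<open>Differences of points of that ball bound the operators near the origin.\<close>
  have small: "norm (T n z) \<le> 2 * real m" if "norm z < r" for n z
  proof -
    have "x0 + z \<in> F m" "x0 \<in> F m" using ball that r by (auto simp: dist_norm)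
    then have "norm (T n (x0 + z)) \<le> real m" "norm (T n x0) \<le> real m" by (auto simp: F_def)
    moreover have "T n z = T n (x0 + z) - T n x0" by (simp add: add)
    ultimately show ?thesis using norm_triangle_ineq4 [of "T n (x0 + z)" "T n x0"] by simp
  qed
  have "norm (T n x) \<le> 4 * real m / r * norm x" for n x
  proof (cases "x = 0")
    case True
    then show ?thesis using diff [of n 0 0] by simp
  next
    case False
    define c :: 'k where "c = of_real (r / 2 / norm x)"
    have c: "norm c = r / 2 / norm x" using r unfolding c_def by (simp only: norm_of_real) simp
    have "norm (T n (sX c x)) \<le> 2 * real m"
      by (rule small) (use r False in \<open>simp add: norm_scale c\<close>)
    then show ?thesis using r False by (simp add: scale c field_simps)
  qed
  then show ?thesis using that [of "4 * real m / r"] r by simp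
qed

lemma (in banach_over) schauder_frame_partial_sums_bounded:
  assumes "schauder_frame (space_of sX) x f"
  obtains C where "0 \<le> C" and "\<And>n v. norm (\<Sum>i<n. sX (f i v) (x i)) \<le> C * norm v"
proof -
  have add: "f n (u + v) = f n u + f n v" and scale: "f n (sX c u) = c * f n u" 
    and bnd: "\<exists>B. \<forall>v. norm (f n v) \<le> B * norm v" for n u v c
    using assms by (auto simp: schauder_frame_def dual_def)
  have conv: "(\<lambda>n. sX (f n v) (x n)) sums v" for v
    using assms by (simp add: schauder_frame_space_of)
  define S where "S n v = (\<Sum>i<n. sX (f i v) (x i))" for n v
  show thesis
  proof (rule uniform_boundedness [of S])
    show "S n (u + v) = S n u + S n v" for n u v
      by (simp add: S_def add scale_left_distrib sum.distrib)
    have "S n (sX c v) = sX c (S n v)" for n c v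
      by (simp add: S_def scale scale_sum_right)
    then show "norm (S n (sX c v)) = norm c * norm (S n v)" for n c v
      by (simp add: norm_scale)
    show "\<exists>B. \<forall>v. norm (S n v) \<le> B * norm v" for n
    proof -
      obtain B where B: "\<And>i v. norm (f i v) \<le> B i * norm v" using bnd by metis
      have "norm (S n v) \<le> (\<Sum>i<n. B i * norm (x i)) * norm v" for v
      proof -
        have "norm (S n v) \<le> (\<Sum>i<n. norm (f i v) * norm (x i))"
          unfolding S_def by (rule sum_norm_le) (simp add: norm_scale)
        also have "\<dots> \<le> (\<Sum>i<n. B i * norm v * norm (x i))"
          by (intro sum_mono mult_right_mono B) simp
        finally show ?thesis by (simp add: sum_distrib_left sum_distrib_right mult_ac)
      qed
      then show ?thesis by blast
    qed
    show "Bseq (\<lambda>n. S n v)" for v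
      using conv [of v] unfolding S_def sums_def by (metis convergent_imp_Bseq convergent_def)
  qed (use that in \<open>simp add: S_def\<close>)
qed

section \<open>Schauder frames of a completion\<close>

context seminormed_space
begin

lemma dual_norm_diff_le:
  assumes "\<phi> \<in> dual E"
  obtains B where "0 \<le> B"
    and "\<And>u v. \<lbrakk>u \<in> carrier E; v \<in> carrier E\<rbrakk> \<Longrightarrow> norm (\<phi> u - \<phi> v) \<le> B * vdist E u v"
proof -
  obtain B where B: "\<forall>u\<in>carrier E. norm (\<phi> u) \<le> B * vnorm E u"
    using assms by (auto simp: dual_def)
  show thesis
  proof (rule that [of "\<bar>B\<bar>"])
    fix u v assume uv: "u \<in> carrier E" "v \<in> carrier E"
    let ?w = "vadd E u (vscale E (- 1) v)"
    have w: "?w \<in> carrier E" using uv by (simp add: vs(1,2))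
    have "\<phi> ?w = \<phi> u + - 1 * \<phi> v"
      using assms uv scale_closed [OF uv(2)] unfolding dual_def by simp
    then have "norm (\<phi> u - \<phi> v) = norm (\<phi> ?w)" by simp
    also have "\<dots> \<le> B * vnorm E ?w" using B w by blast
    also have "\<dots> \<le> \<bar>B\<bar> * vdist E u v"
      unfolding vdist_def by (intro mult_right_mono norm_nonneg w) simp
    finally show "norm (\<phi> u - \<phi> v) \<le> \<bar>B\<bar> * vdist E u v" .
  qed simp
qed

text \<open>
  The representative is a choice, but the limit does not depend on it: a functional of \<open>E\<close> is
  Lipschitz, so it takes nearby values on equivalent sequences (\<open>dual_extension_tendsto\<close>).
\<close>

definition dual_extension :: "('v \<Rightarrow> 'k) \<Rightarrow> (nat \<Rightarrow> 'v) set \<Rightarrow> 'k" where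
  "dual_extension \<phi> U = lim (\<lambda>n. \<phi> ((SOME s. s \<in> U) n))"

lemma dual_Cauchy:
  assumes \<phi>: "\<phi> \<in> dual E" and s: "vCauchy E s"
  shows "Cauchy (\<lambda>n. \<phi> (s n))"
proof (rule metric_CauchyI)
  obtain B where B: "0 \<le> B" 
    "\<And>u v. \<lbrakk>u \<in> carrier E; v \<in> carrier E\<rbrakk> \<Longrightarrow> norm (\<phi> u - \<phi> v) \<le> B * vdist E u v"
    using dual_norm_diff_le [OF \<phi>] by blast
  fix e :: real assume "0 < e"
  then obtain M where M: "\<forall>m\<ge>M. \<forall>n\<ge>M. vdist E (s m) (s n) < e / (B + 1)"
    using vCauchyD [OF s, of "e / (B + 1)"] B(1) by auto
  have "dist (\<phi> (s m)) (\<phi> (s n)) < e" if "M \<le> m" "M \<le> n" for m n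
  proof -
    have "dist (\<phi> (s m)) (\<phi> (s n)) \<le> B * vdist E (s m) (s n)"
      using B(2) s by (simp add: dist_norm vCauchy_closed)
    also have "\<dots> \<le> (B + 1) * vdist E (s m) (s n)"
      using s by (intro mult_right_mono vdist_nonneg) (auto simp: vCauchy_closed)
    also have "\<dots> < e"
      using M that B(1) by (simp add: pos_less_divide_eq mult.commute)
    finally show ?thesis .
  qed
  then show "\<exists>M. \<forall>m\<ge>M. \<forall>n\<ge>M. dist (\<phi> (s m)) (\<phi> (s n)) < e" by blast
qed

lemma dual_extension_tendsto:
  assumes \<phi>: "\<phi> \<in> dual E" and s: "vCauchy E s"
  shows "(\<lambda>n. \<phi> (s n)) \<longlonglongrightarrow> dual_extension \<phi> (null_rel E `` {s})"
proof -
  define t where "t = (SOME t. t \<in> null_rel E `` {s})"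
  have "s \<in> null_rel E `` {s}"
    using s equiv_class_self [OF equiv_null_rel] by simp
  then have "t \<in> null_rel E `` {s}" unfolding t_def by (rule someI [of "\<lambda>t. t \<in> null_rel E `` {s}"])
  then have t: "vCauchy E t" and st: "(\<lambda>n. vdist E (s n) (t n)) \<longlonglongrightarrow> 0"
    by (auto simp: null_rel_def)
  obtain B where B: "0 \<le> B" 
    "\<And>u v. \<lbrakk>u \<in> carrier E; v \<in> carrier E\<rbrakk> \<Longrightarrow> norm (\<phi> u - \<phi> v) \<le> B * vdist E u v"
    using dual_norm_diff_le [OF \<phi>] by blast
  have "(\<lambda>n. \<phi> (t n)) \<longlonglongrightarrow> lim (\<lambda>n. \<phi> (t n))"
    using Cauchy_convergent [OF dual_Cauchy [OF \<phi> t]] by (simp add: convergent_LIMSEQ_iff)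
  moreover have "(\<lambda>n. \<phi> (s n) - \<phi> (t n)) \<longlonglongrightarrow> 0"
    by (rule Lim_null_comparison [OF _ tendsto_mult_right_zero [OF st, of B]])
      (use s t B in \<open>auto simp: vCauchy_closed\<close>)
  ultimately have "(\<lambda>n. \<phi> (s n) - \<phi> (t n) + \<phi> (t n)) \<longlonglongrightarrow> 0 + lim (\<lambda>n. \<phi> (t n))"
    by (intro tendsto_add)
  then show ?thesis by (simp add: dual_extension_def t_def)
qed

lemma dual_extension_eqI:
  "\<lbrakk>\<phi> \<in> dual E; vCauchy E s; (\<lambda>n. \<phi> (s n)) \<longlonglongrightarrow> r\<rbrakk> \<Longrightarrow> dual_extension \<phi> (null_rel E `` {s}) = r"
  using dual_extension_tendsto LIMSEQ_unique by blast

lemma dual_extension_in_dual: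
  assumes \<phi>: "\<phi> \<in> dual E"
  shows "dual_extension \<phi> \<in> dual (completion E)"
proof -
  let ?k = "\<lambda>s. null_rel E `` {s}"
  have add: "dual_extension \<phi> (vadd (completion E) (?k s) (?k t))
      = dual_extension \<phi> (?k s) + dual_extension \<phi> (?k t)" if "vCauchy E s" "vCauchy E t" for s t
  proof -
    have "(\<lambda>n. \<phi> (s n) + \<phi> (t n)) \<longlonglongrightarrow> dual_extension \<phi> (?k s) + dual_extension \<phi> (?k t)"
      by (intro tendsto_add dual_extension_tendsto \<phi> that)
    moreover have "\<phi> (vadd E (s n) (t n)) = \<phi> (s n) + \<phi> (t n)" for n
      using \<phi> that by (simp add: dual_def vCauchy_closed)
    ultimately show ?thesis
      using that by (simp add: vadd_completion dual_extension_eqI [OF \<phi>] vCauchy_add)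
  qed
  have scale: "dual_extension \<phi> (vscale (completion E) c (?k s)) = c * dual_extension \<phi> (?k s)"
    if "vCauchy E s" for c s
  proof -
    have "(\<lambda>n. c * \<phi> (s n)) \<longlonglongrightarrow> c * dual_extension \<phi> (?k s)"
      by (intro tendsto_mult_left dual_extension_tendsto \<phi> that)
    moreover have "\<phi> (vscale E c (s n)) = c * \<phi> (s n)" for n
      using \<phi> that by (simp add: dual_def vCauchy_closed)
    ultimately show ?thesis
      using that by (simp add: vscale_completion dual_extension_eqI [OF \<phi>] vCauchy_scale)
  qed
  obtain B where B: "\<And>u. u \<in> carrier E \<Longrightarrow> norm (\<phi> u) \<le> B * vnorm E u"
    using \<phi> unfolding dual_def by blast
  have "norm (dual_extension \<phi> (?k s)) \<le> B * vnorm (completion E) (?k s)" if "vCauchy E s" for s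
    by (rule LIMSEQ_le [OF tendsto_norm [OF dual_extension_tendsto [OF \<phi> that]]
          tendsto_mult_left [OF vnorm_completion [OF that]]])
      (use B that in \<open>auto simp: vCauchy_closed\<close>)
  with add scale show ?thesis
    unfolding dual_def carrier_completion by auto
qed

text \<open>
  Partial sums of a frame expansion, indexed by a list so that they can be handled by induction
  on its constructors.
\<close>

definition expansion :: "(nat \<Rightarrow> 'v) \<Rightarrow> (nat \<Rightarrow> 'v \<Rightarrow> 'k) \<Rightarrow> nat list \<Rightarrow> 'v \<Rightarrow> 'v" where
  "expansion z \<phi> ns u = vsum E (map (\<lambda>n. vscale E (\<phi> n u) (z n)) ns)"

lemma expansion_Nil: "expansion z \<phi> [] u = vzero E"
  and expansion_Cons:
    "expansion z \<phi> (i # ns) u = vadd E (vscale E (\<phi> i u) (z i)) (expansion z \<phi> ns u)"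
  by (simp_all add: expansion_def vsum_def)

lemma expansion_closed:
  assumes "\<And>n. z n \<in> carrier E"
  shows "expansion z \<phi> ns u \<in> carrier E"
  by (induction ns) (simp_all add: expansion_Nil expansion_Cons vs(1-3) assms)

lemma vdist_scale_left:
  assumes "u \<in> carrier E"
  shows "vdist E (vscale E c u) (vscale E d u) = norm (c - d) * vnorm E u"
  using assms add_scale [of u c "- d"]
  by (simp add: vdist_def scale_scale norm_scale [symmetric])

text \<open>
  Linearity of the partial sums, in the form that turns a bound on norms into a Lipschitz bound.
\<close>

lemma vdist_expansion:
  assumes z: "\<And>n. z n \<in> carrier E" and \<phi>: "\<And>n. \<phi> n \<in> dual E"
    and u: "u \<in> carrier E" and v: "v \<in> carrier E"
  shows "vdist E (expansion z \<phi> ns u) (expansion z \<phi> ns v)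
    = vnorm E (expansion z \<phi> ns (vadd E u (vscale E (- 1) v)))"
proof -
  let ?w = "vadd E u (vscale E (- 1) v)"
  have "expansion z \<phi> ns ?w
      = vadd E (expansion z \<phi> ns u) (vscale E (- 1) (expansion z \<phi> ns v))"
  proof (induction ns)
    case Nil
    show ?case by (simp add: expansion_Nil scale_zero_right add_zero zero_closed)
  next
    case (Cons i ns)
    have "\<phi> i ?w = \<phi> i u + - 1 * \<phi> i v"
      using \<phi> [of i] u scale_closed [OF v] v unfolding dual_def by simp
    then have "vscale E (\<phi> i ?w) (z i)
        = vadd E (vscale E (\<phi> i u) (z i)) (vscale E (- 1) (vscale E (\<phi> i v) (z i)))"
      using add_scale [OF z, of "\<phi> i u" "- 1 * \<phi> i v" i] by (simp add: scale_scale z)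
    then show ?case
      using Cons.IH by (simp add: expansion_Cons vs expansion_closed z)
  qed
  then show ?thesis by (simp add: vdist_def)
qed

lemma scaled_Cauchy:
  assumes u: "u \<in> carrier E" and a: "Cauchy a"
  shows "vCauchy E (\<lambda>m. vscale E (a m) u)"
proof (rule vCauchyI)
  fix e :: real assume e: "0 < e"
  have n: "0 \<le> vnorm E u" using u by (rule norm_nonneg)
  obtain M where M: "\<And>m n. \<lbrakk>M \<le> m; M \<le> n\<rbrakk> \<Longrightarrow> norm (a m - a n) < e / (vnorm E u + 1)"
    using CauchyD [OF a, of "e / (vnorm E u + 1)"] e n by force
  have "vdist E (vscale E (a m) u) (vscale E (a n) u) < e" if "M \<le> m" "M \<le> n" for m n
  proof -
    have "norm (a m - a n) * vnorm E u \<le> norm (a m - a n) * (vnorm E u + 1)"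
      by (intro mult_left_mono) auto
    also have "\<dots> < e" using M [OF that] n by (simp add: pos_less_divide_eq)
    finally show ?thesis by (simp add: vdist_scale_left u)
  qed
  then show "\<exists>M. \<forall>m\<ge>M. \<forall>n\<ge>M. vdist E (vscale E (a m) u) (vscale E (a n) u) < e" by blast
qed (use u in \<open>simp add: scale_closed\<close>)

text \<open>
  A scalar may be replaced by a sequence converging to it: this lets the coefficients
  \<open>lim \<phi>(s m)\<close> of an expansion in the completion be computed termwise along \<open>s\<close>.
\<close>

lemma vscale_embed:
  assumes u: "u \<in> carrier E" and a: "a \<longlonglongrightarrow> c"
  shows "vscale (completion E) c (embed u) = null_rel E `` {\<lambda>m. vscale E (a m) u}"
proof -
  have C: "vCauchy E (\<lambda>m. vscale E (a m) u)"
    using u a by (intro scaled_Cauchy) (auto simp: LIMSEQ_imp_Cauchy)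
  have "(\<lambda>m. c - a m) \<longlonglongrightarrow> c - c" by (intro tendsto_diff tendsto_const a)
  then have "(\<lambda>m. norm (c - a m) * vnorm E u) \<longlonglongrightarrow> 0"
    by (intro tendsto_mult_left_zero tendsto_norm_zero) simp
  then have "null_rel E `` {\<lambda>m. vscale E c u} = null_rel E `` {\<lambda>m. vscale E (a m) u}"
    using u C by (simp add: null_class_eq_iff vCauchy_const scale_closed vdist_scale_left)
  then show ?thesis using u by (simp add: embed_def vscale_completion vCauchy_const)
qed

text \<open>
  The partial sum operators of the completion are the continuous extensions of those of \<open>E\<close>.
\<close>

lemma expansion_completion:
  assumes z: "\<And>n. z n \<in> carrier E" and \<phi>: "\<And>n. \<phi> n \<in> dual E" and s: "vCauchy E s"
  shows "vCauchy E (\<lambda>m. expansion z \<phi> ns (s m)) \<and>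
    vsum (completion E) (map (\<lambda>n. vscale (completion E)
        (dual_extension (\<phi> n) (null_rel E `` {s})) (embed (z n))) ns)
      = null_rel E `` {\<lambda>m. expansion z \<phi> ns (s m)}"
proof (induction ns)
  case Nil
  show ?case by (simp add: expansion_Nil vsum_def vzero_completion vCauchy_const zero_closed)
next
  case (Cons i ns)
  have "vCauchy E (\<lambda>m. vscale E (\<phi> i (s m)) (z i))"
    by (intro scaled_Cauchy z dual_Cauchy \<phi> s)
  with Cons.IH show ?case
    using vscale_embed [OF z dual_extension_tendsto [OF \<phi> s], of i i]
    by (simp add: expansion_Cons vsum_def vCauchy_add vadd_completion)
qed

text \<open>
  An element of the completion is within \<open>\<epsilon>\<close> of some \<open>v\<close> in \<open>E\<close>.  A partial sum operator \<open>P\<close> of norm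
  at most \<open>K\<close> moves it by at most \<open>K \<epsilon> + \<parallel>P v - v\<parallel> + \<epsilon>\<close>, and the middle term tends to zero.
\<close>

lemma schauder_frame_completion:
  assumes z: "\<And>n. z n \<in> carrier E" and \<phi>: "\<And>n. \<phi> n \<in> dual E" and K: "0 \<le> K"
    and bound: "\<And>N u. u \<in> carrier E \<Longrightarrow> vnorm E (expansion z \<phi> [0..<N] u) \<le> K * vnorm E u"
    and conv: "\<And>u. u \<in> carrier E \<Longrightarrow> vlimit E (\<lambda>N. expansion z \<phi> [0..<N] u) u"
  shows "schauder_frame (completion E) (\<lambda>n. embed (z n)) (\<lambda>n. dual_extension (\<phi> n))"
proof -
  have "vlimit (completion E) (\<lambda>N. vsum (completion E) (map (\<lambda>n. vscale (completion E)
      (dual_extension (\<phi> n) U) (embed (z n))) [0..<N])) U"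
    if UC: "U \<in> carrier (completion E)" for U
  proof -
    obtain s where s: "vCauchy E s" and U: "U = null_rel E `` {s}"
      using UC by (auto simp: carrier_completion)
    have scl: "s m \<in> carrier E" for m using s by (rule vCauchy_closed)
    define P where "P N u = expansion z \<phi> [0..<N] u" for N u
    have Pcl: "P N u \<in> carrier E" for N u unfolding P_def by (rule expansion_closed) (rule z)
    have PC: "vCauchy E (\<lambda>m. P N (s m))" for N
      unfolding P_def using expansion_completion [of z \<phi> s "[0..<N]", OF z \<phi> s] by blast
    define d where "d N = vdist (completion E) (null_rel E `` {\<lambda>m. P N (s m)}) U" for N
    have d_lim: "(\<lambda>m. vdist E (P N (s m)) (s m)) \<longlonglongrightarrow> d N" for N
      unfolding d_def U by (rule vdist_completion [OF PC s])
    have d_nonneg: "0 \<le> d N" for N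
      by (rule LIMSEQ_le_const [OF d_lim]) (auto intro!: vdist_nonneg Pcl scl)
    have "d \<longlonglongrightarrow> 0"
    proof (rule LIMSEQ_I)
      fix e :: real assume e: "0 < e"
      \<comment> \<open>With this choice the two error terms \<open>K * \<epsilon>\<close> and \<open>\<epsilon>\<close> add up to half of \<open>e\<close>.\<close>
      define \<epsilon> where "\<epsilon> = e / (2 * (K + 1))"
      have \<epsilon>: "0 < \<epsilon>" "(K + 1) * \<epsilon> = e / 2" using e K by (auto simp: \<epsilon>_def field_simps)
      obtain M where M: "\<forall>m\<ge>M. \<forall>n\<ge>M. vdist E (s m) (s n) < \<epsilon>"
        using vCauchyD [OF s \<epsilon>(1)] by blast
      have d_le: "d N \<le> vdist E (P N (s M)) (s M) + e / 2" for N
      proof (rule LIMSEQ_le_const2 [OF d_lim], intro exI allI impI)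
        fix m assume "M \<le> m"
        then have sm: "vdist E (s m) (s M) \<le> \<epsilon>" using M by (simp add: less_imp_le)
        have "vdist E (P N (s m)) (P N (s M)) \<le> K * vdist E (s m) (s M)"
          unfolding P_def vdist_expansion [OF z \<phi> scl scl] unfolding vdist_def
          by (rule bound) (intro add_closed scale_closed scl)
        also have "\<dots> \<le> K * \<epsilon>" using sm K by (rule mult_left_mono)
        finally have Pm: "vdist E (P N (s m)) (P N (s M)) \<le> K * \<epsilon>" .
        have "vdist E (P N (s m)) (s m)
            \<le> vdist E (P N (s m)) (P N (s M)) + vdist E (P N (s M)) (s m)"
          by (intro vdist_triangle Pcl scl)
        also have "vdist E (P N (s M)) (s m) \<le> vdist E (P N (s M)) (s M) + vdist E (s M) (s m)"
          by (intro vdist_triangle Pcl scl)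
        finally have "vdist E (P N (s m)) (s m)
            \<le> K * \<epsilon> + (vdist E (P N (s M)) (s M) + \<epsilon>)"
          using Pm sm vdist_commute [OF scl scl, of M m] by linarith
        also have "\<dots> = vdist E (P N (s M)) (s M) + e / 2"
          using \<epsilon>(2) by (simp add: algebra_simps)
        finally show "vdist E (P N (s m)) (s m) \<le> vdist E (P N (s M)) (s M) + e / 2" .
      qed
      have "(\<lambda>N. vdist E (P N (s M)) (s M)) \<longlonglongrightarrow> 0"
        using conv [OF scl] by (simp add: vlimit_def P_def)
      then obtain L where L: "\<And>N. L \<le> N \<Longrightarrow> vdist E (P N (s M)) (s M) < e / 2"
        using order_tendstoD(2) [of _ 0 sequentially "e / 2"] e
        by (auto simp: eventually_sequentially)
      have "norm (d N - 0) < e" if "L \<le> N" for N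
        using d_le [of N] L [OF that] d_nonneg [of N] by simp
      then show "\<exists>L. \<forall>N\<ge>L. norm (d N - 0) < e" by blast
    qed
    then show ?thesis
      using expansion_completion [of z \<phi> s, OF z \<phi> s] by (simp add: vlimit_def d_def [abs_def] P_def U)
  qed
  then show ?thesis
    by (simp add: schauder_frame_def embed_closed z dual_extension_in_dual \<phi>)
qed

end

section \<open>Functionals on the algebraic tensor product\<close>

text \<open>
  The functional \<open>f \<otimes> g\<close> as a linear form on the free vector space; it descends to the tensor
  product because it vanishes on the bilinearity relations (\<open>tensor_functional_span\<close>).
\<close>

definition tensor_functional ::
  "('a \<Rightarrow> 'k) \<Rightarrow> ('b \<Rightarrow> 'k) \<Rightarrow> (('a \<times> 'b) \<Rightarrow>\<^sub>0 'k::field) \<Rightarrow> 'k" where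
  "tensor_functional f g u =
     (\<Sum>k\<in>Poly_Mapping.keys u. Poly_Mapping.lookup u k * (f (fst k) * g (snd k)))"

text \<open>
  The supports of \<open>u\<close>, \<open>v\<close> and \<open>u + v\<close> differ; additivity needs sums over a common index set.
\<close>

lemma tensor_functional_superset:
  assumes "finite A" "Poly_Mapping.keys u \<subseteq> A"
  shows "tensor_functional f g u = (\<Sum>k\<in>A. Poly_Mapping.lookup u k * (f (fst k) * g (snd k)))"
  unfolding tensor_functional_def
  by (rule sum.mono_neutral_left) (use assms in \<open>auto simp: in_keys_iff\<close>)

lemma tensor_functional_gen [simp]: "tensor_functional f g (free_gen x y) = f x * g y"
  by (subst tensor_functional_superset [of "{(x, y)}"]) auto

lemma tensor_functional_zero [simp]: "tensor_functional f g 0 = 0"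
  by (simp add: tensor_functional_def)

lemma tensor_functional_add:
  "tensor_functional f g (u + v) = tensor_functional f g u + tensor_functional f g v"
proof -
  let ?A = "Poly_Mapping.keys u \<union> Poly_Mapping.keys v"
  have "tensor_functional f g w = (\<Sum>k\<in>?A. Poly_Mapping.lookup w k * (f (fst k) * g (snd k)))"
    if "Poly_Mapping.keys w \<subseteq> ?A" for w
    by (rule tensor_functional_superset) (use that in auto)
  from this [of u] this [of v] this [of "u + v"] show ?thesis
    using keys_add [of u v] by (simp add: lookup_add distrib_right sum.distrib)
qed

lemma tensor_functional_scale:
  "tensor_functional f g (free_scale c u) = c * tensor_functional f g u"
  by (subst tensor_functional_superset [of "Poly_Mapping.keys u"])
    (auto simp: tensor_functional_def sum_distrib_left mult.assoc in_keys_iff)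

lemma tensor_functional_diff:
  "tensor_functional f g (u - v) = tensor_functional f g u - tensor_functional f g v"
  using tensor_functional_add [of f g "u - v" v] by simp

lemma tensor_functional_span:
  assumes f: "\<And>x x'. f (x + x') = f x + f x'" "\<And>c x. f (sX c x) = c * f x"
    and g: "\<And>y y'. g (y + y') = g y + g y'" "\<And>c y. g (sY c y) = c * g y"
    and u: "u \<in> free.span (bilinear_relations sX sY)"
  shows "tensor_functional f g u = 0"
proof -
  have "free.span (bilinear_relations sX sY) \<subseteq> {u. tensor_functional f g u = 0}"
  proof (rule free.span_minimal)
    show "bilinear_relations sX sY \<subseteq> {u. tensor_functional f g u = 0}"
      by (auto simp: bilinear_relations_def tensor_functional_diff tensor_functional_add
          tensor_functional_scale f g distrib_left distrib_right mult_ac)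
    show "free.subspace {u. tensor_functional f g u = 0}"
      by (simp add: free.subspace_def tensor_functional_add tensor_functional_scale)
  qed
  with u show ?thesis by blast
qed

definition class_functional :: "('c \<Rightarrow> 'k) \<Rightarrow> 'c set \<Rightarrow> 'k" where
  "class_functional h U = h (SOME u. u \<in> U)"

lemma class_functional_class:
  assumes "\<And>u v. u - v \<in> free.span (bilinear_relations sX sY) \<Longrightarrow> h u = h v"
  shows "class_functional h (tensor_rel sX sY `` {u}) = h u"
proof -
  have "u \<in> tensor_rel sX sY `` {u}" by (simp add: tensor_rel_def free.span_zero)
  then have "(SOME v. v \<in> tensor_rel sX sY `` {u}) \<in> tensor_rel sX sY `` {u}"
    by (rule someI [of "\<lambda>v. v \<in> tensor_rel sX sY `` {u}"])
  then have "h u = h (SOME v. v \<in> tensor_rel sX sY `` {u})"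
    by (intro assms) (simp add: tensor_rel_def)
  then show ?thesis by (simp add: class_functional_def)
qed

section \<open>The projective seminorm on representatives\<close>

locale banach_pair = X: banach_over sX + Y: banach_over sY
  for sX :: "'k::{real_normed_field, banach} \<Rightarrow> 'a::banach \<Rightarrow> 'a"
    and sY :: "'k \<Rightarrow> 'b::banach \<Rightarrow> 'b"
begin

abbreviation relations :: "(('a \<times> 'b) \<Rightarrow>\<^sub>0 'k) set" where
  "relations \<equiv> free.span (bilinear_relations sX sY)"

abbreviation tensor_class :: "(('a \<times> 'b) \<Rightarrow>\<^sub>0 'k) \<Rightarrow> (('a \<times> 'b) \<Rightarrow>\<^sub>0 'k) set" where
  "tensor_class u \<equiv> tensor_rel sX sY `` {u}"

definition \<pi> :: "(('a \<times> 'b) \<Rightarrow>\<^sub>0 'k) \<Rightarrow> real" where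
  "\<pi> u = projective_norm sX sY (tensor_class u)"

sublocale A: seminormed_space "algebraic_tensor sX sY"
  by (rule seminormed_space_algebraic_tensor) unfold_locales

lemma relation_add_left: "free_gen (x + x') y - (free_gen x y + free_gen x' y) \<in> relations"
  and relation_add_right: "free_gen x (y + y') - (free_gen x y + free_gen x y') \<in> relations"
  and relation_scale_left: "free_gen (sX c x) y - free_scale c (free_gen x y) \<in> relations"
  and relation_scale_right: "free_gen x (sY c y) - free_scale c (free_gen x y) \<in> relations"
  by (rule free.span_base, force simp: bilinear_relations_def)+

lemma relations_trans: "\<lbrakk>u - v \<in> relations; v - w \<in> relations\<rbrakk> \<Longrightarrow> u - w \<in> relations"
  using free.span_add [of "u - v" _ "v - w"] by simp

lemma relations_cong_add:
  "\<lbrakk>u - v \<in> relations; u' - v' \<in> relations\<rbrakk> \<Longrightarrow> (u + u') - (v + v') \<in> relations"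
  using free.span_add [of "u - v" _ "u' - v'"] by (simp add: add_diff_add)

lemma gen_zero_left: "free_gen 0 y \<in> relations"
  and gen_zero_right: "free_gen x 0 \<in> relations"
  using relation_add_left [of 0 0 y] relation_add_right [of x 0 0] free.span_neg by fastforce+

lemma \<pi>_cong: "u - v \<in> relations \<Longrightarrow> \<pi> u = \<pi> v"
  by (simp add: \<pi>_def tensor_class_eq_iff [symmetric])

lemma \<pi>_nonneg: "0 \<le> \<pi> u"
  by (simp add: \<pi>_def projective_norm_nonneg)

lemma \<pi>_add: "\<pi> (u + v) \<le> \<pi> u + \<pi> v"
  by (simp add: \<pi>_def projective_norm_triangle)

lemma \<pi>_scale: "\<pi> (free_scale c u) = norm c * \<pi> u"
  by (simp add: \<pi>_def X.projective_norm_scale)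

lemma \<pi>_zero: "\<pi> 0 = 0"
  using \<pi>_scale [of 0 0] by simp

lemma \<pi>_gen: "\<pi> (free_gen x y) \<le> norm x * norm y"
  unfolding \<pi>_def using projective_norm_le [of _ sX sY "[(x, y)]"] by simp

text \<open>
  The universal property of the projective norm, as the largest seminorm with
  \<open>\<pi> (x \<otimes> y) \<le> \<parallel>x\<parallel> \<parallel>y\<parallel>\<close>: a bound for a subadditive function on elementary tensors carries over to
  every representation of \<open>u\<close> as a sum of such tensors, hence to their infimum.  It gives both the
  continuity of \<open>f \<otimes> g\<close> and the bound on partial sum operators.
\<close>

lemma seminorm_le_\<pi>:
  fixes q :: "(('a \<times> 'b) \<Rightarrow>\<^sub>0 'k) \<Rightarrow> real"
  assumes cong: "\<And>u v. u - v \<in> relations \<Longrightarrow> q u = q v"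
    and zero: "q 0 \<le> 0" and add: "\<And>u v. q (u + v) \<le> q u + q v"
    and gen: "\<And>x y. q (free_gen x y) \<le> K * (norm x * norm y)" and K: "0 \<le> K"
  shows "q u \<le> K * \<pi> u"
proof (rule field_le_epsilon)
  fix e :: real assume e: "0 < e"
  define d where "d = e / (K + 1)"
  have d: "0 < d" "K * d \<le> e" using e K by (auto simp: d_def field_simps)
  obtain ps where ps: "tensor_class u = tensor_class (\<Sum>(x, y)\<leftarrow>ps. free_gen x y)"
      "(\<Sum>(x, y)\<leftarrow>ps. norm x * norm y) < \<pi> u + d"
    using projective_norm_less [of sX sY u "\<pi> u + d"] d by (auto simp: \<pi>_def)
  have "q (\<Sum>(x, y)\<leftarrow>ps. free_gen x y) \<le> K * (\<Sum>(x, y)\<leftarrow>ps. norm x * norm y)" for ps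
  proof (induction ps)
    case Nil
    show ?case using zero by simp
  next
    case (Cons p ps)
    obtain x y where p: "p = (x, y)" by force
    have "q (\<Sum>(x, y)\<leftarrow>p # ps. free_gen x y) \<le> q (free_gen x y) + q (\<Sum>(x, y)\<leftarrow>ps. free_gen x y)"
      using add by (simp only: p list.map sum_list.Cons prod.case)
    also have "\<dots> \<le> K * (norm x * norm y) + K * (\<Sum>(x, y)\<leftarrow>ps. norm x * norm y)"
      by (intro add_mono gen Cons.IH)
    finally show ?case by (simp only: p list.map sum_list.Cons prod.case distrib_left)
  qed
  moreover have "q u = q (\<Sum>(x, y)\<leftarrow>ps. free_gen x y)"
    using ps(1) by (intro cong) (simp add: tensor_class_eq_iff)
  ultimately have "q u \<le> K * (\<Sum>(x, y)\<leftarrow>ps. norm x * norm y)" by metis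
  also have "\<dots> \<le> K * (\<pi> u + d)" using ps(2) K by (intro mult_left_mono) auto
  also have "\<dots> \<le> K * \<pi> u + e" using d by (simp add: algebra_simps)
  finally show "q u \<le> K * \<pi> u + e" .
qed

lemma tensor_functional_cong:
  assumes f: "f \<in> dual (space_of sX)" and g: "g \<in> dual (space_of sY)"
    and uv: "u - v \<in> relations"
  shows "tensor_functional f g u = tensor_functional f g v"
proof -
  have "tensor_functional f g (u - v) = 0"
    by (rule tensor_functional_span [OF _ _ _ _ uv]) (use f g in \<open>auto simp: dual_def\<close>)
  then show ?thesis by (simp add: tensor_functional_diff)
qed

lemma class_functional_tensor:
  assumes "f \<in> dual (space_of sX)" and "g \<in> dual (space_of sY)"
  shows "class_functional (tensor_functional f g) (tensor_class u) = tensor_functional f g u"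
  by (rule class_functional_class) (rule tensor_functional_cong [OF assms])

lemma class_functional_in_dual:
  assumes f: "f \<in> dual (space_of sX)" and g: "g \<in> dual (space_of sY)"
  shows "class_functional (tensor_functional f g) \<in> dual (algebraic_tensor sX sY)"
proof -
  obtain B C where B: "\<And>x. norm (f x) \<le> B * norm x" and C: "\<And>y. norm (g y) \<le> C * norm y"
    using f g by (auto simp: dual_def)
  have "norm (tensor_functional f g u) \<le> (\<bar>B\<bar> * \<bar>C\<bar>) * \<pi> u" for u
  proof (rule seminorm_le_\<pi>)
    show "norm (tensor_functional f g (free_gen x y)) \<le> \<bar>B\<bar> * \<bar>C\<bar> * (norm x * norm y)" for x y
    proof -
      have "norm (f x) \<le> \<bar>B\<bar> * norm x" "norm (g y) \<le> \<bar>C\<bar> * norm y"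
        using B [of x] C [of y] by (meson abs_ge_self mult_right_mono norm_ge_zero order_trans)+
      then have "norm (f x) * norm (g y) \<le> (\<bar>B\<bar> * norm x) * (\<bar>C\<bar> * norm y)"
        by (intro mult_mono) auto
      then show ?thesis by (simp add: norm_mult mult_ac)
    qed
  qed (auto simp: tensor_functional_add norm_triangle_ineq
      intro!: arg_cong [of _ _ norm] tensor_functional_cong [OF f g])
  then show ?thesis
    unfolding dual_def
    by (auto simp: carrier_algebraic_tensor vadd_algebraic_tensor vscale_algebraic_tensor
        vnorm_algebraic_tensor class_functional_tensor [OF f g] tensor_functional_add tensor_functional_scale
        \<pi>_def [symmetric])
qed

end

section \<open>The square ordering\<close>

text \<open>
  The pairs with maximum \<open>n\<close> occupy the positions from \<open>n\<^sup>2\<close> to \<open>n\<^sup>2 + 2 n\<close>: first the row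
  \<open>(n, 0), \<dots>, (n, n - 1)\<close>, then the column \<open>(0, n), \<dots>, (n, n)\<close> with the corner at its end.
\<close>

definition square_order :: "nat \<Rightarrow> nat \<times> nat" where
  "square_order k = (let n = floor_sqrt k; r = k - n\<^sup>2 in if r < n then (n, r) else (r - n, n))"

lemma floor_sqrt_at_top: "filterlim floor_sqrt sequentially sequentially"
  unfolding filterlim_at_top
proof
  fix m
  show "\<forall>\<^sub>F N in sequentially. m \<le> floor_sqrt N"
    using eventually_ge_at_top [of "m\<^sup>2"] by eventually_elim (rule le_floor_sqrtI)
qed

context banach_pair
begin

text \<open>
  Modulo the bilinearity relations, the sum of all \<open>a\<^sub>i \<otimes> b\<^sub>j\<close> over the first \<open>n\<^sup>2 + r\<close> pairs of
  the square ordering, where \<open>r \<le> 2 n + 1\<close>.  Three tensors suffice, so that norm estimates do not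
  grow with the number of pairs.  Truncated subtraction makes the column part empty as long as the row is incomplete.
\<close>

definition square_form :: "(nat \<Rightarrow> 'a) \<Rightarrow> (nat \<Rightarrow> 'b) \<Rightarrow> nat \<Rightarrow> nat \<Rightarrow> ('a \<times> 'b) \<Rightarrow>\<^sub>0 'k" where
  "square_form a b n r =
     free_gen (\<Sum>i<n. a i) (\<Sum>j<n. b j)
     + free_gen (a n) (\<Sum>j<min r n. b j)
     + free_gen (\<Sum>i<r - n. a i) (b n)"

lemma square_form_step:
  assumes "r \<le> 2 * n"
  shows "square_form a b n (Suc r)
    - (square_form a b n r + (if r < n then free_gen (a n) (b r) else free_gen (a (r - n)) (b n)))
    \<in> relations"
proof (cases "r < n")
  case True
  then have "min (Suc r) n = Suc r" "min r n = r" "Suc r - n = 0" "r - n = 0" by auto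
  then show ?thesis
    using True relation_add_right [of "a n" "\<Sum>j<r. b j" "b r"]
    by (simp add: square_form_def algebra_simps)
next
  case False
  then have "min (Suc r) n = n" "min r n = n" "Suc r - n = Suc (r - n)" by auto
  then show ?thesis
    using False relation_add_left [of "\<Sum>i<r - n. a i" "a (r - n)" "b n"]
    by (simp add: square_form_def algebra_simps)
qed

text \<open>
  A square with its new row and column completed is the next square:
  \<open>A \<otimes> B + a \<otimes> B + (A + a) \<otimes> b = (A + a) \<otimes> (B + b)\<close>.
\<close>

lemma square_form_next:
  "square_form a b n (2 * n + 1) - square_form a b (Suc n) 0 \<in> relations"
proof -
  let ?A = "\<Sum>i<n. a i" and ?B = "\<Sum>j<n. b j"
  let ?S = "free_gen ?A ?B + free_gen (a n) ?B + free_gen (?A + a n) (b n)"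
  have m: "min (2 * n + 1) n = n" "2 * n + 1 - n = Suc n" by auto
  have "(free_gen ?A ?B + free_gen (a n) ?B) - free_gen (?A + a n) ?B \<in> relations"
    using free.span_neg [OF relation_add_left [of ?A "a n" ?B]] by simp
  from relations_cong_add [OF this, of "free_gen (?A + a n) (b n)" "free_gen (?A + a n) (b n)"]
  have "?S - (free_gen (?A + a n) ?B + free_gen (?A + a n) (b n)) \<in> relations"
    by (simp add: free.span_zero)
  moreover have "(free_gen (?A + a n) ?B + free_gen (?A + a n) (b n))
      - free_gen (?A + a n) (?B + b n) \<in> relations"
    using free.span_neg [OF relation_add_right [of "?A + a n" ?B "b n"]] by simp
  ultimately have "?S - free_gen (?A + a n) (?B + b n) \<in> relations"
    by (rule relations_trans)
  moreover have "- (free_gen (a (Suc n)) 0 + free_gen 0 (b (Suc n))) \<in> relations"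
    by (intro free.span_neg free.span_add gen_zero_left gen_zero_right)
  ultimately have "(?S - free_gen (?A + a n) (?B + b n))
      + - (free_gen (a (Suc n)) 0 + free_gen 0 (b (Suc n))) \<in> relations"
    by (rule free.span_add)
  then show ?thesis unfolding square_form_def m by (simp add: algebra_simps)
qed

lemma square_partial_sum:
  "(\<Sum>k<N. free_gen (a (fst (square_order k))) (b (snd (square_order k))))
     - square_form a b (floor_sqrt N) (N - (floor_sqrt N)\<^sup>2) \<in> relations"
proof (induction N)
  case 0
  have "free_gen 0 0 + free_gen (a 0) 0 + free_gen 0 (b 0) \<in> relations"
    by (intro free.span_add gen_zero_left gen_zero_right)
  then show ?case using free.span_neg by (force simp: square_form_def)
next
  case (Suc N)
  define n where "n = floor_sqrt N"
  define r where "r = N - n\<^sup>2"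
  have N: "N = n\<^sup>2 + r" using floor_sqrt_power2_le [of N] by (simp add: n_def r_def)
  have "N < (Suc n)\<^sup>2" unfolding n_def by (rule Suc_floor_sqrt_power2_gt)
  then have r: "r \<le> 2 * n" by (simp add: N power2_eq_square)
  let ?t = "if r < n then free_gen (a n) (b r) else free_gen (a (r - n)) (b n)"
  let ?s = "\<Sum>k<N. free_gen (a (fst (square_order k))) (b (snd (square_order k)))"
  have t: "free_gen (a (fst (square_order N))) (b (snd (square_order N))) = ?t"
    by (simp add: square_order_def n_def [symmetric] r_def [symmetric] Let_def)
  have "?s - square_form a b n r \<in> relations"
    using Suc.IH by (simp add: n_def r_def)
  then have "(?s + ?t) - (square_form a b n r + ?t) \<in> relations" by simp
  moreover have "(square_form a b n r + ?t) - square_form a b n (Suc r) \<in> relations"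
    using free.span_neg [OF square_form_step [OF r, of a b]] by simp
  ultimately have step: "(?s + ?t) - square_form a b n (Suc r) \<in> relations"
    by (rule relations_trans)
  show ?case
  proof (cases "r = 2 * n")
    case True
    then have SN: "Suc N = (Suc n)\<^sup>2" by (simp add: N power2_eq_square)
    have "(?s + ?t) - square_form a b (Suc n) 0 \<in> relations"
      using relations_trans [OF step] square_form_next [of a b n] True by simp
    moreover have "floor_sqrt (Suc N) = Suc n" unfolding SN by simp
    ultimately show ?thesis by (simp only: sum.lessThan_Suc t) (simp add: SN)
  next
    case False
    have "floor_sqrt (Suc N) = n"
      by (rule floor_sqrt_unique) (use False r in \<open>auto simp: N power2_eq_square\<close>)
    then show ?thesis using step by (simp only: sum.lessThan_Suc t) (simp add: N)
  qed
qed

lemma \<pi>_square_form_le: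
  "\<pi> (square_form a b n r) \<le> norm (\<Sum>i<n. a i) * norm (\<Sum>j<n. b j)
     + norm (a n) * norm (\<Sum>j<min r n. b j) + norm (\<Sum>i<r - n. a i) * norm (b n)"
  unfolding square_form_def by (intro order_trans [OF \<pi>_add] add_mono \<pi>_gen)

text \<open>
  The square part \<open>A \<otimes> B\<close> is compared with \<open>x \<otimes> y\<close> by
  \<open>A \<otimes> B - x \<otimes> y = (A - x) \<otimes> B + x \<otimes> (B - y)\<close>.
\<close>

lemma \<pi>_square_form_diff_le:
  "\<pi> (square_form a b n r - free_gen x y) \<le> norm ((\<Sum>i<n. a i) - x) * norm (\<Sum>j<n. b j)
     + norm x * norm ((\<Sum>j<n. b j) - y)
     + norm (a n) * norm (\<Sum>j<min r n. b j) + norm (\<Sum>i<r - n. a i) * norm (b n)"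
proof -
  let ?A = "\<Sum>i<n. a i" and ?B = "\<Sum>j<n. b j"
  let ?R = "free_gen (a n) (\<Sum>j<min r n. b j) + free_gen (\<Sum>i<r - n. a i) (b n)"
  have "(free_gen ?A ?B - (free_gen (?A - x) ?B + free_gen x ?B))
      + (free_gen x ?B - (free_gen x (?B - y) + free_gen x y)) \<in> relations"
    using relation_add_left [of "?A - x" x ?B] relation_add_right [of x "?B - y" y]
    by (intro free.span_add) simp_all
  then have "(square_form a b n r - free_gen x y)
      - (free_gen (?A - x) ?B + free_gen x (?B - y) + ?R) \<in> relations"
    by (simp add: square_form_def algebra_simps)
  from \<pi>_cong [OF this] show ?thesis
    by (simp add: add.assoc [symmetric])
       (intro order_trans [OF \<pi>_add] add_mono \<pi>_gen)
qed

text \<open>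
  These are the two hypotheses of the completion criterion.  Both concern the operators \<open>P\<^sub>N\<close> on
  representatives, and both reduce to elementary tensors, where \<open>square_form\<close> computes \<open>P\<^sub>N\<close>.
\<close>

lemma schauder_frame_algebraic_expansion:
  assumes fx: "schauder_frame (space_of sX) x f" and gy: "schauder_frame (space_of sY) y g"
  defines "z \<equiv> \<lambda>k. tensor_class (free_gen (x (fst (square_order k))) (y (snd (square_order k))))"
    and "\<phi> \<equiv> \<lambda>k. class_functional
      (tensor_functional (f (fst (square_order k))) (g (snd (square_order k))))"
  obtains K where "0 \<le> K"
    and "\<And>N u. u \<in> carrier (algebraic_tensor sX sY) \<Longrightarrow>
      vnorm (algebraic_tensor sX sY) (A.expansion z \<phi> [0..<N] u)
        \<le> K * vnorm (algebraic_tensor sX sY) u"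
    and "\<And>u. u \<in> carrier (algebraic_tensor sX sY) \<Longrightarrow>
      vlimit (algebraic_tensor sX sY) (\<lambda>N. A.expansion z \<phi> [0..<N] u) u"
proof -
  let ?i = "\<lambda>k. fst (square_order k)" and ?j = "\<lambda>k. snd (square_order k)"
  obtain C where C: "0 \<le> C" "\<And>n v. norm (\<Sum>i<n. sX (f i v) (x i)) \<le> C * norm v"
    using X.schauder_frame_partial_sums_bounded [OF fx] by blast
  obtain D where D: "0 \<le> D" "\<And>n v. norm (\<Sum>i<n. sY (g i v) (y i)) \<le> D * norm v"
    using Y.schauder_frame_partial_sums_bounded [OF gy] by blast
  have f: "f n \<in> dual (space_of sX)" and g: "g n \<in> dual (space_of sY)" for n
    using fx gy by (auto simp: schauder_frame_def)
  have fs: "(\<lambda>n. sX (f n v) (x n)) sums v" for v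
    using fx by (simp add: X.schauder_frame_space_of)
  have gs: "(\<lambda>n. sY (g n w) (y n)) sums w" for w
    using gy by (simp add: Y.schauder_frame_space_of)
  define h where "h k = tensor_functional (f (?i k)) (g (?j k))" for k
  define P where "P N u = (\<Sum>k<N. free_scale (h k u) (free_gen (x (?i k)) (y (?j k))))" for N u
  have P_add: "P N (u + v) = P N u + P N v" for N u v
    by (simp add: P_def h_def tensor_functional_add free.scale_left_distrib sum.distrib)
  have P_zero: "P N 0 = 0" for N by (simp add: P_def h_def)
  have P_cong: "P N u = P N v" if "u - v \<in> relations" for N u v
    unfolding P_def h_def
    using tensor_functional_cong [OF f g that] by simp
  have expansion: "A.expansion z \<phi> [0..<N] (tensor_class u) = tensor_class (P N u)" for N u
  proof -
    have "A.expansion z \<phi> ks (tensor_class u) = tensor_class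
        (\<Sum>k\<leftarrow>ks. free_scale (h k u) (free_gen (x (?i k)) (y (?j k))))" for ks
      by (induction ks) (simp_all add: A.expansion_Nil A.expansion_Cons vzero_algebraic_tensor
          z_def \<phi>_def class_functional_tensor [OF f g] h_def
          vscale_algebraic_tensor vadd_algebraic_tensor)
    then show ?thesis
      by (simp add: P_def interv_sum_list_conv_sum_set_nat atLeast0LessThan)
  qed
  have P_gen: "P N (free_gen v w) - square_form (\<lambda>i. sX (f i v) (x i)) (\<lambda>j. sY (g j w) (y j))
      (floor_sqrt N) (N - (floor_sqrt N)\<^sup>2) \<in> relations" for N v w
  proof -
    have bil: "free_scale (c * d) (free_gen p q) - free_gen (sX c p) (sY d q) \<in> relations"
      for c d p q
    proof -
      have "free_gen (sX c p) (sY d q) - free_scale c (free_gen p (sY d q)) \<in> relations"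
        by (rule relation_scale_left)
      moreover have "free_scale c (free_gen p (sY d q) - free_scale d (free_gen p q)) \<in> relations"
        by (intro free.span_scale relation_scale_right)
      ultimately have "(free_gen (sX c p) (sY d q) - free_scale c (free_gen p (sY d q)))
          + free_scale c (free_gen p (sY d q) - free_scale d (free_gen p q)) \<in> relations"
        by (rule free.span_add)
      from free.span_neg [OF this] show ?thesis
        by (simp add: free.scale_right_diff_distrib)
    qed
    have "P N (free_gen v w) - (\<Sum>k<N. free_gen (sX (f (?i k) v) (x (?i k))) (sY (g (?j k) w) (y (?j k))))
        \<in> relations"
      unfolding P_def sum_subtractf [symmetric] h_def tensor_functional_gen
      by (intro free.span_sum bil)
    then show ?thesis by (rule relations_trans) (rule square_partial_sum)
  qed
  \<comment> \<open>A single term is the difference of two partial sums, hence the factor 2 here and the total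
    \<open>1 + 2 + 2 = 5\<close> below.\<close>
  have term_X: "norm (sX (f n v) (x n)) \<le> 2 * C * norm v" for n v
  proof -
    have "norm (sX (f n v) (x n)) = norm ((\<Sum>i<Suc n. sX (f i v) (x i)) - (\<Sum>i<n. sX (f i v) (x i)))" by simp
    also have "\<dots> \<le> C * norm v + C * norm v"
      by (intro order_trans [OF norm_triangle_ineq4] add_mono C)
    finally show ?thesis by simp
  qed
  have term_Y: "norm (sY (g n w) (y n)) \<le> 2 * D * norm w" for n w
  proof -
    have "norm (sY (g n w) (y n)) = norm ((\<Sum>i<Suc n. sY (g i w) (y i)) - (\<Sum>i<n. sY (g i w) (y i)))" by simp
    also have "\<dots> \<le> D * norm w + D * norm w"
      by (intro order_trans [OF norm_triangle_ineq4] add_mono D)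
    finally show ?thesis by simp
  qed
  have P_bound: "\<pi> (P N u) \<le> (5 * C * D) * \<pi> u" for N u
  proof (rule seminorm_le_\<pi>)
    show "\<pi> (P N (free_gen v w)) \<le> 5 * C * D * (norm v * norm w)" for v w
    proof -
      have "\<pi> (P N (free_gen v w)) \<le> (C * norm v) * (D * norm w)
          + (2 * C * norm v) * (D * norm w) + (C * norm v) * (2 * D * norm w)"
        unfolding \<pi>_cong [OF P_gen]
        by (rule order_trans [OF \<pi>_square_form_le])
          (intro add_mono mult_mono C D term_X term_Y mult_nonneg_nonneg norm_ge_zero, simp_all add: C D)
      then show ?thesis by (simp add: algebra_simps)
    qed
  qed (use C(1) D(1) in \<open>simp_all add: P_add P_zero \<pi>_zero \<pi>_add P_cong\<close>)
  have conv_gen: "(\<lambda>N. \<pi> (P N (free_gen v w) - free_gen v w)) \<longlonglongrightarrow> 0" for v w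
  proof (rule null_sandwich)
    let ?a = "\<lambda>i. sX (f i v) (x i)" and ?b = "\<lambda>j. sY (g j w) (y j)"
    let ?e = "\<lambda>n. norm ((\<Sum>i<n. ?a i) - v) * (D * norm w) + norm v * norm ((\<Sum>j<n. ?b j) - w)
      + norm (?a n) * (D * norm w) + (C * norm v) * norm (?b n)"
    have "?e \<longlonglongrightarrow> 0"
    proof (intro tendsto_add_zero tendsto_mult_left_zero tendsto_mult_right_zero tendsto_norm_zero)
      show "(\<lambda>n. (\<Sum>i<n. ?a i) - v) \<longlonglongrightarrow> 0"
        using fs [of v] by (simp add: sums_def LIM_zero_iff)
      show "?a \<longlonglongrightarrow> 0"
        using fs [of v] by (rule summable_LIMSEQ_zero [OF sums_summable])
      show "(\<lambda>n. (\<Sum>j<n. ?b j) - w) \<longlonglongrightarrow> 0"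
        using gs [of w] by (simp add: sums_def LIM_zero_iff)
      show "?b \<longlonglongrightarrow> 0"
        using gs [of w] by (rule summable_LIMSEQ_zero [OF sums_summable])
    qed
    then show "(\<lambda>N. ?e (floor_sqrt N)) \<longlonglongrightarrow> 0"
      by (rule filterlim_compose) (rule floor_sqrt_at_top)
    show "\<pi> (P N (free_gen v w) - free_gen v w) \<le> ?e (floor_sqrt N)" for N
    proof -
      let ?Q = "square_form ?a ?b (floor_sqrt N) (N - (floor_sqrt N)\<^sup>2)"
      have "\<pi> (P N (free_gen v w) - free_gen v w) = \<pi> (?Q - free_gen v w)"
        by (rule \<pi>_cong) (use P_gen [of N v w] in simp)
      also have "\<dots> \<le> ?e (floor_sqrt N)"
        by (rule order_trans [OF \<pi>_square_form_diff_le])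
          (intro add_mono mult_mono order_refl C D norm_ge_zero mult_nonneg_nonneg)
      finally show ?thesis .
    qed
  qed (rule \<pi>_nonneg)
  have conv: "(\<lambda>N. \<pi> (P N u - u)) \<longlonglongrightarrow> 0" for u
  proof -
    obtain ps where "tensor_class u = tensor_class (\<Sum>(v, w)\<leftarrow>ps. free_gen v w)"
      using tensor_class_sum [of sX sY u] by blast
    then have u: "u - (\<Sum>(v, w)\<leftarrow>ps. free_gen v w) \<in> relations"
      by (simp add: tensor_class_eq_iff)
    have "(\<lambda>N. \<pi> (P N (\<Sum>(v, w)\<leftarrow>ps. free_gen v w) - (\<Sum>(v, w)\<leftarrow>ps. free_gen v w))) \<longlonglongrightarrow> 0"
    proof (induction ps)
      case Nil
      show ?case by (simp add: P_zero \<pi>_zero)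
    next
      case (Cons p ps)
      obtain v w where p: "p = (v, w)" by force
      let ?s = "\<Sum>(v, w)\<leftarrow>ps. free_gen v w :: ('a \<times> 'b) \<Rightarrow>\<^sub>0 'k"
      have "(\<lambda>N. \<pi> (P N (free_gen v w) - free_gen v w) + \<pi> (P N ?s - ?s)) \<longlonglongrightarrow> 0"
        by (intro tendsto_add_zero conv_gen Cons.IH)
      then have "(\<lambda>N. \<pi> (P N (free_gen v w + ?s) - (free_gen v w + ?s))) \<longlonglongrightarrow> 0"
      proof (rule null_sandwich)
        show "\<pi> (P N (free_gen v w + ?s) - (free_gen v w + ?s))
            \<le> \<pi> (P N (free_gen v w) - free_gen v w) + \<pi> (P N ?s - ?s)" for N
          using \<pi>_add [of "P N (free_gen v w) - free_gen v w" "P N ?s - ?s"]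
          by (simp only: P_add add_diff_add)
      qed (rule \<pi>_nonneg)
      then show ?case by (simp only: p list.map sum_list.Cons prod.case)
    qed
    moreover have "\<pi> (P N u - u)
        = \<pi> (P N (\<Sum>(v, w)\<leftarrow>ps. free_gen v w) - (\<Sum>(v, w)\<leftarrow>ps. free_gen v w))" for N
      using free.span_neg [OF u] P_cong [OF u, of N] by (intro \<pi>_cong) simp
    ultimately show ?thesis by simp
  qed
  show thesis
  proof (rule that [of "5 * C * D"])
    show "vnorm (algebraic_tensor sX sY) (A.expansion z \<phi> [0..<N] u)
        \<le> 5 * C * D * vnorm (algebraic_tensor sX sY) u"
      if "u \<in> carrier (algebraic_tensor sX sY)" for N u
      using that P_bound
      by (auto simp: carrier_algebraic_tensor expansion vnorm_algebraic_tensor \<pi>_def [symmetric])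
    show "vlimit (algebraic_tensor sX sY) (\<lambda>N. A.expansion z \<phi> [0..<N] u) u"
      if "u \<in> carrier (algebraic_tensor sX sY)" for u
    proof -
      have "vdist (algebraic_tensor sX sY) (tensor_class u) (tensor_class v) = \<pi> (u - v)" for u v
        by (simp add: vdist_def vscale_algebraic_tensor vadd_algebraic_tensor
            vnorm_algebraic_tensor \<pi>_def)
      then show ?thesis
        using that conv by (auto simp: carrier_algebraic_tensor expansion vlimit_def)
    qed
  qed (simp add: C D)
qed

end

theorem proposition4:
  fixes sX :: "'k::{real_normed_field, banach} \<Rightarrow> 'a::banach \<Rightarrow> 'a"
    and sY :: "'k \<Rightarrow> 'b::banach \<Rightarrow> 'b"
  assumes "banach_over sX" and "banach_over sY"
    and "\<exists>x f. schauder_frame (space_of sX) x f"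
    and "\<exists>y g. schauder_frame (space_of sY) y g"
  shows "\<exists>z h. schauder_frame (projective_tensor sX sY) z h"
proof -
  interpret banach_pair sX sY
    using assms(1,2) by (rule banach_pair.intro)
  obtain x f y g where fx: "schauder_frame (space_of sX) x f"
    and gy: "schauder_frame (space_of sY) y g"
    using assms(3,4) by blast
  define z where "z k = tensor_class (free_gen (x (fst (square_order k))) (y (snd (square_order k))))"
    for k
  define \<phi> where "\<phi> k = class_functional
    (tensor_functional (f (fst (square_order k))) (g (snd (square_order k))))" for k
  have z: "z k \<in> carrier (algebraic_tensor sX sY)" for k
    by (simp add: z_def carrier_algebraic_tensor)
  have \<phi>: "\<phi> k \<in> dual (algebraic_tensor sX sY)" for k
    unfolding \<phi>_def using fx gy
    by (intro class_functional_in_dual) (auto simp: schauder_frame_def)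
  obtain K where "0 \<le> K"
    and "\<And>N u. u \<in> carrier (algebraic_tensor sX sY) \<Longrightarrow>
      vnorm (algebraic_tensor sX sY) (A.expansion z \<phi> [0..<N] u)
        \<le> K * vnorm (algebraic_tensor sX sY) u"
    and "\<And>u. u \<in> carrier (algebraic_tensor sX sY) \<Longrightarrow>
      vlimit (algebraic_tensor sX sY) (\<lambda>N. A.expansion z \<phi> [0..<N] u) u"
    using schauder_frame_algebraic_expansion [OF fx gy] unfolding z_def \<phi>_def by blast
  from A.schauder_frame_completion [OF z \<phi> this] show ?thesis
    unfolding projective_tensor_def by blast
qed

end
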